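(* Let $q\ge3$, let $g\in\mathbb{F}_q[t]$ be a non-constant square-free polynomial, and let $\ell$ be a prime factor of $q-1$. Let $P_1,\dots,P_s$ be all the monic irreducible factors of $g$ whose degrees do not divide $\deg g$, and assume $\deg P_i=\ell$ for all $1\le i\le s$. Then there exist infinitely many cyclic extensions $K$ of $\mathbb{F}_q(t)$ of degree $\ell$ whose discriminants are relatively prime to $g$ such that $g$ is Carmichael in $K$.
   Context: $\mathbb{F}_q$ is the finite field with $q$ elements. A finite ring $S$ is a Carmichael ring if $S$ is not a field and $a^{|S|}=a$ for every $a\in S$; an ideal $I$ of a ring $R$ is a Carmichael ideal if $R/I$ is a Carmichael ring. For a finite extension $K$ of $\mathbb{F}_q(t)$, $\mathcal{O}_K$ denotes the integral closure of $\mathbb{F}_q[t]$ in $K$, and an element $\alpha\in\mathcal{O}_K$ is Carmichael in $K$ if $\alpha\mathcal{O}_K$ is a Carmichael ideal of $\mathcal{O}_K$. The discriminant of $K$ is the discriminant ideal of $\mathcal{O}_K$ over $\mathbb{F}_q[t]$; "relatively prime to $g$" means no irreducible factor of $g$ divides it. *)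

theory Defs
  imports "HOL-Algebra.Algebraic_Closure_Type" "HOL-Algebra.QuotRing"
          "HOL-Computational_Algebra.Squarefree" "HOL-Combinatorics.Permutations"
begin

text \<open>Ambient setting. The finite field F_q is a finite type 'a of class field.
  F_q[t] is 'a poly, F_q(t) is 'a poly fract, and all finite extensions of F_q(t)
  are taken inside the fixed algebraic closure ('a poly fract) alg_closure.\<close>

type_synonym 'a omega = "'a poly fract alg_closure"

definition emb :: "'a::field poly \<Rightarrow> 'a omega" where
  "emb p = to_ac (Fract p 1)"

definition base_field :: "'a::field omega set" where
  "base_field = range to_ac"

definition is_subfield :: "'a::field omega set \<Rightarrow> bool" where
  "is_subfield K \<longleftrightarrow> 0 \<in> K \<and> 1 \<in> K \<and>
     (\<forall>x\<in>K. \<forall>y\<in>K. x + y \<in> K \<and> x * y \<in> K) \<and>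
     (\<forall>x\<in>K. - x \<in> K) \<and> (\<forall>x\<in>K. x \<noteq> 0 \<longrightarrow> inverse x \<in> K)"

definition is_basis :: "'a::field omega set \<Rightarrow> nat \<Rightarrow> (nat \<Rightarrow> 'a omega) \<Rightarrow> bool" where
  "is_basis K n b \<longleftrightarrow> (\<forall>i<n. b i \<in> K) \<and>
     (\<forall>x\<in>K. \<exists>!c. (\<forall>i<n. c i \<in> base_field) \<and> (\<forall>i\<ge>n. c i = 0) \<and> x = (\<Sum>i<n. c i * b i))"

definition ext_degree :: "'a::field omega set \<Rightarrow> nat" where
  "ext_degree K = (SOME n. \<exists>b. is_basis K n b)"

definition coords :: "'a::field omega set \<Rightarrow> nat \<Rightarrow> (nat \<Rightarrow> 'a omega) \<Rightarrow> 'a omega \<Rightarrow> nat \<Rightarrow> 'a omega" where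
  "coords K n b x = (THE c. (\<forall>i<n. c i \<in> base_field) \<and> (\<forall>i\<ge>n. c i = 0) \<and> x = (\<Sum>i<n. c i * b i))"

definition trace :: "'a::field omega set \<Rightarrow> 'a omega \<Rightarrow> 'a omega" where
  "trace K x = (let n = ext_degree K; b = (SOME b. is_basis K n b)
                in \<Sum>i<n. coords K n b (x * b i) i)"

definition gal :: "'a::field omega set \<Rightarrow> ('a omega \<Rightarrow> 'a omega) set" where
  "gal K = {\<sigma>. bij_betw \<sigma> K K \<and>
     (\<forall>x\<in>K. \<forall>y\<in>K. \<sigma> (x + y) = \<sigma> x + \<sigma> y \<and> \<sigma> (x * y) = \<sigma> x * \<sigma> y) \<and>
     (\<forall>x\<in>base_field. \<sigma> x = x) \<and> (\<forall>x. x \<notin> K \<longrightarrow> \<sigma> x = x)}"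

definition cyclic_ext :: "'a::field omega set \<Rightarrow> nat \<Rightarrow> bool" where
  "cyclic_ext K n \<longleftrightarrow> is_subfield K \<and> base_field \<subseteq> K \<and> (\<exists>b. is_basis K n b) \<and>
     card (gal K) = n \<and> (\<exists>\<sigma>\<in>gal K. \<forall>\<tau>\<in>gal K. \<exists>k. \<tau> = \<sigma> ^^ k)"

definition OK :: "'a::field omega set \<Rightarrow> 'a omega set" where
  "OK K = {x \<in> K. \<exists>f :: 'a poly poly. lead_coeff f = 1 \<and> poly (map_poly emb f) x = 0}"

definition OK_ring :: "'a::field omega set \<Rightarrow> 'a omega ring" where
  "OK_ring K = \<lparr> carrier = OK K, monoid.mult = (\<lambda>x y. x * y), one = 1,
                 ring.zero = 0, add = (\<lambda>x y. x + y) \<rparr>"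

text \<open>Generators of the discriminant ideal of O_K over F_q[t]:
  the polynomials d with d = det(Tr(x_i x_j)) for x_0..x_{n-1} in O_K.\<close>
definition disc_gens :: "'a::field omega set \<Rightarrow> 'a poly set" where
  "disc_gens K = {d. \<exists>x. (\<forall>i<ext_degree K. x i \<in> OK K) \<and>
     emb d = (\<Sum>p | p permutes {..<ext_degree K}.
                of_int (sign p) * (\<Prod>i<ext_degree K. trace K (x i * x (p i))))}"

text \<open>The discriminant (ideal generated by disc_gens) is relatively prime to g:
  no irreducible factor of g divides it.\<close>
definition disc_coprime :: "'a::field omega set \<Rightarrow> 'a poly \<Rightarrow> bool" where
  "disc_coprime K g \<longleftrightarrow>
     (\<forall>P. irreducible P \<and> P dvd g \<longrightarrow> \<not> (\<forall>d\<in>disc_gens K. P dvd d))"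

definition carmichael_ring :: "('b, 'c) ring_scheme \<Rightarrow> bool" where
  "carmichael_ring S \<longleftrightarrow> ring S \<and> finite (carrier S) \<and> \<not> field S \<and>
     (\<forall>a\<in>carrier S. a [^]\<^bsub>S\<^esub> card (carrier S) = a)"

definition carmichael_ideal :: "('b, 'c) ring_scheme \<Rightarrow> 'b set \<Rightarrow> bool" where
  "carmichael_ideal R I \<longleftrightarrow> ideal I R \<and> carmichael_ring (R Quot I)"

definition carmichael_in :: "'a::field omega set \<Rightarrow> 'a poly \<Rightarrow> bool" where
  "carmichael_in K g \<longleftrightarrow> carmichael_ideal (OK_ring K) (PIdl\<^bsub>OK_ring K\<^esub> (emb g))"

end

theory Submission
  imports Defs "Jordan_Normal_Form.Char_Poly"
begin

text \<open>
  Write \<open>q\<close> for the number of elements of the ground field. The extensions are the Kummer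
  extensions generated by an \<open>l\<close>-th root \<open>x\<close> of \<open>D = 1 + t * g ^ (q * n)\<close> for \<open>n \<ge> 1\<close>.
  Since the derivative of \<open>D\<close> is \<open>g ^ (q * n)\<close>, \<open>D\<close> is squarefree; hence the ring of integers is the
  free module on \<open>1, x, \<dots>, x ^ (l - 1)\<close> and the discriminant of this basis is a unit times a power
  of \<open>D\<close>, which is 1 modulo \<open>g\<close>. The quotient by \<open>g\<close> has \<open>N = q ^ (l * degree g)\<close> elements.
  The degree of every irreducible factor of \<open>g\<close> divides \<open>l * degree g\<close>, so \<open>c ^ N\<close> is \<open>c\<close> modulo \<open>g\<close> for
  polynomials \<open>c\<close>; also \<open>x ^ N\<close> is \<open>x\<close> modulo \<open>g\<close>, because \<open>x ^ l = D\<close> is 1 and \<open>N\<close> is 1 modulo \<open>l\<close>.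
  As \<open>N\<close> is a power of \<open>q\<close>, raising to the \<open>N\<close>-th power is additive, which gives the identity for all
  integers. Different \<open>n\<close> yield different fields because the degree of \<open>D\<close> is determined by the field.
\<close>

section \<open>Divisibility of polynomials and reduced fractions\<close>

lemma irreducible_factor_exists:
  fixes p :: "'a::field poly"
  assumes "degree p > 0"
  shows "\<exists>P. irreducible P \<and> P dvd p"
  using assms
proof (induction "degree p" arbitrary: p rule: less_induct)
  case less
  show ?case
  proof (cases "irreducible p")
    case False
    have "p \<noteq> 0" "\<not> is_unit p" using less.prems by (auto simp: is_unit_iff_degree)
    with False obtain a b where ab: "p = a * b" "\<not> is_unit a" "\<not> is_unit b"
      by (auto simp: irreducible_def)
    hence nz: "a \<noteq> 0" "b \<noteq> 0" using \<open>p \<noteq> 0\<close> by auto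
    hence "degree a > 0" "degree b > 0" using ab by (auto simp: is_unit_iff_degree)
    moreover have "degree p = degree a + degree b" using ab nz by (simp add: degree_mult_eq)
    ultimately show ?thesis using less.hyps[of a] ab(1) by (auto intro: dvd_mult2)
  qed auto
qed

text \<open>Split off one prime factor, \<open>p = P * h\<close>. By induction \<open>h\<close>
  divides \<open>f\<close>; squarefreeness keeps \<open>P\<close> out of \<open>h\<close>, so
  primality places \<open>P\<close> in the cofactor.\<close>

lemma squarefree_dvd:
  fixes p f :: "'a::field poly"
  assumes "squarefree p" "p \<noteq> 0" "\<And>P. irreducible P \<Longrightarrow> P dvd p \<Longrightarrow> P dvd f"
  shows "p dvd f"
  using assms
proof (induction "degree p" arbitrary: p rule: less_induct)
  case less
  show ?case
  proof (cases "degree p = 0")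
    case True
    hence "is_unit p" using less.prems by (auto simp: is_unit_iff_degree)
    thus ?thesis by (rule unit_imp_dvd)
  next
    case False
    then obtain P where P: "irreducible P" "P dvd p"
      using irreducible_factor_exists by blast
    then obtain h where h: "p = P * h" by blast
    have nz: "P \<noteq> 0" "h \<noteq> 0" using h less.prems by auto
    have prime: "prime_elem P" using P by (simp add: field_poly_irreducible_imp_prime)
    have "\<not> is_unit P" using P unfolding irreducible_def by blast
    hence "degree P > 0" using nz by (auto simp: is_unit_iff_degree)
    hence "degree h < degree p" using h nz by (simp add: degree_mult_eq)
    moreover have "squarefree h" using less.prems(1) h squarefree_multD(2) by blast
    ultimately have "h dvd f"
      by (rule less.hyps) (use less.prems h nz in auto)
    then obtain k where k: "f = h * k" by blast
    have "P dvd h * k" using less.prems(3) P k by auto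
    moreover have "\<not> P dvd h"
    proof
      assume "P dvd h"
      hence "P ^ 2 dvd p" using h by (auto simp: power2_eq_square)
      with less.prems(1) \<open>\<not> is_unit P\<close> show False by (auto simp: squarefree_def)
    qed
    ultimately have "P dvd k" using prime by (auto simp: prime_elem_dvd_mult_iff)
    thus ?thesis using h k by (simp add: mult.commute mult_dvd_mono)
  qed
qed

text \<open>Count factors of \<open>P\<close>: a squarefree \<open>D\<close> contributes at most
  \<open>i < l\<close> of them to \<open>D ^ i\<close>, so if \<open>c\<close> contributed none, not
  even \<open>P ^ Suc i\<close> could divide the product.\<close>

lemma prime_elem_dvd_of_power_dvd:
  fixes P D c :: "'a::field poly"
  assumes "prime_elem P" "squarefree D" "i < l" "P ^ l dvd c ^ l * D ^ i"
  shows "P dvd c"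
proof (rule ccontr)
  assume nc: "\<not> P dvd c"
  have nzP: "P \<noteq> 0" and nu: "\<not> is_unit P" using assms(1) unfolding prime_elem_def by blast+
  have "\<not> P dvd c ^ l" using nc assms(1) prime_elem_dvd_power by blast
  hence dv: "P ^ Suc i dvd c ^ l * D ^ i"
    using assms(3,4) by (meson Suc_leI dvd_trans le_imp_power_dvd)
  show False
  proof (cases "P dvd D")
    case True
    then obtain E where E: "D = P * E" by blast
    have "\<not> P dvd E"
    proof
      assume "P dvd E"
      hence "P ^ 2 dvd D" using E by (auto simp: power2_eq_square)
      with assms(2) nu show False by (auto simp: squarefree_def)
    qed
    hence "\<not> P dvd c ^ l * E ^ i"
      using \<open>\<not> P dvd c ^ l\<close> assms(1) by (metis prime_elem_dvd_mult_iff prime_elem_dvd_power)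
    moreover have "P ^ i * P dvd P ^ i * (c ^ l * E ^ i)"
      using dv E by (simp add: power_mult_distrib mult_ac)
    ultimately show False using nzP by simp
  next
    case False
    hence "\<not> P dvd c ^ l * D ^ i"
      using \<open>\<not> P dvd c ^ l\<close> assms(1) by (metis prime_elem_dvd_mult_iff prime_elem_dvd_power)
    thus False using dv by (metis dvd_mult_left power_Suc)
  qed
qed

text \<open>A denominator of least degree works, since cancelling a common prime factor would lower
  the degree.\<close>

lemma reduced_fraction_exists:
  fixes z :: "'a::field poly fract"
  obtains u v where "v \<noteq> 0" "z = Fract u v" "\<And>P. prime_elem P \<Longrightarrow> P dvd v \<Longrightarrow> \<not> P dvd u"
proof -
  define S where "S = {n. \<exists>u v. v \<noteq> 0 \<and> z = Fract u v \<and> degree v = n}"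
  obtain u0 v0 where "v0 \<noteq> 0" "z = Fract u0 v0" by (cases z) auto
  hence "degree v0 \<in> S" by (auto simp: S_def)
  hence "(LEAST n. n \<in> S) \<in> S" by (rule LeastI)
  then obtain u v where uv: "v \<noteq> 0" "z = Fract u v" "degree v = (LEAST n. n \<in> S)"
    by (auto simp: S_def)
  show ?thesis
  proof (rule that[OF uv(1,2)])
    fix P assume P: "prime_elem P" "P dvd v"
    show "\<not> P dvd u"
    proof
      assume "P dvd u"
      then obtain u' v' where *: "u = P * u'" "v = P * v'" using P by blast
      hence nz: "P \<noteq> 0" "v' \<noteq> 0" using uv by auto
      have "degree P > 0" using P nz by (auto simp: prime_elem_def is_unit_iff_degree)
      hence "degree v' < degree v" using * nz by (simp add: degree_mult_eq)
      moreover have "z = Fract u' v'" using uv(2) * nz by (simp add: mult_fract_cancel)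
      ultimately show False using uv(3) nz not_less_Least[of "degree v'" "\<lambda>n. n \<in> S"]
        by (auto simp: S_def)
    qed
  qed
qed

text \<open>A denominator without prime factors is a nonzero constant and can be absorbed into the
  numerator. With \<open>reduced_fraction_exists\<close> this is how fractions are shown to be
  polynomials.\<close>

lemma reduced_fraction_unit:
  fixes u v :: "'a::field poly"
  assumes "v \<noteq> 0" "\<And>P. prime_elem P \<Longrightarrow> \<not> P dvd v"
  obtains w where "Fract u v = Fract w 1"
proof -
  have "degree v = 0"
    using irreducible_factor_exists[of v] assms(2) field_poly_irreducible_imp_prime by blast
  hence "is_unit v" using assms by (auto simp: is_unit_iff_degree)
  then obtain w where "1 = v * w" by blast
  hence "Fract u v = Fract (u * w) 1" using assms by (simp add: eq_fract mult_ac)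
  thus ?thesis by (rule that)
qed

section \<open>Finite fields\<close>

text \<open>These are the remainders modulo a polynomial of degree \<open>n\<close>. The zero
  polynomial is listed separately because it has degree 0, so \<open>degree p < n\<close> misses it
  for \<open>n = 0\<close>.\<close>

lemma card_poly_degree_less:
  assumes "finite (UNIV :: 'a::field set)"
  shows "finite {p :: 'a poly. p = 0 \<or> degree p < n}
       \<and> card {p :: 'a poly. p = 0 \<or> degree p < n} = card (UNIV :: 'a set) ^ n"
proof (induction n)
  case 0
  thus ?case by simp
next
  case (Suc n)
  let ?B = "\<lambda>n. {p :: 'a poly. p = 0 \<or> degree p < n}"
  have eq: "?B (Suc n) = (\<lambda>(a, p). pCons a p) ` (UNIV \<times> ?B n)" (is "_ = ?R")
  proof (intro equalityI subsetI)
    fix p assume p: "p \<in> ?B (Suc n)"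
    obtain a r where ar: "p = pCons a r" by (cases p)
    hence "r \<in> ?B n" using p by (auto split: if_splits)
    thus "p \<in> ?R" using ar by auto
  qed (auto split: if_splits)
  have "inj_on (\<lambda>(a, p). pCons a p) (UNIV \<times> ?B n)" by (auto simp: inj_on_def)
  thus ?case using Suc assms unfolding eq
    by (auto simp: card_image card_cartesian_product intro!: finite_cartesian_product finite_imageI)
qed

text \<open>Fermat's little theorem for the residue field of \<open>P\<close>: if \<open>P\<close>
  does not divide \<open>c\<close>, multiplication by \<open>c\<close> permutes the nonzero
  remainders, and the products over all of them can be compared.\<close>

lemma fermat_poly:
  fixes P c :: "'a::field poly"
  assumes fin: "finite (UNIV :: 'a set)" and P: "irreducible P"
  shows "P dvd c ^ (card (UNIV :: 'a set) ^ degree P) - c"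
proof (cases "P dvd c")
  case True
  have "card (UNIV :: 'a set) > 0" using fin by (simp add: card_gt_0_iff)
  hence "c dvd c ^ (card (UNIV :: 'a set) ^ degree P)" by (intro dvd_power) auto
  thus ?thesis using True by (meson dvd_diff dvd_trans)
next
  case False
  let ?q = "card (UNIV :: 'a set) ^ degree P"
  have pr: "prime_elem P" using P by (rule field_poly_irreducible_imp_prime)
  have nzP: "P \<noteq> 0" using pr by auto
  have dP: "degree P > 0" using P nzP by (auto simp: irreducible_def is_unit_iff_degree)
  define B where "B = {p :: 'a poly. p = 0 \<or> degree p < degree P}"
  define R where "R = B - {0}"
  have B: "finite B" "card B = ?q" using card_poly_degree_less[OF fin, of "degree P"] by (auto simp: B_def)
  have R: "finite R" "card R = ?q - 1" using B by (auto simp: R_def B_def card_Diff_singleton)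
  have q0: "?q > 0" using fin by (simp add: card_gt_0_iff)
  have ndvd: "\<not> P dvd r" if "r \<in> R" for r
    using that dvd_imp_degree_le[of P r] by (auto simp: R_def B_def)
  have maps: "(c * r) mod P \<in> R" if "r \<in> R" for r
  proof -
    have "\<not> P dvd c * r" using ndvd[OF that] False pr by (simp add: prime_elem_dvd_mult_iff)
    hence "(c * r) mod P \<noteq> 0" by (simp add: dvd_eq_mod_eq_0)
    thus ?thesis using degree_mod_less[OF nzP, of "c * r"] by (auto simp: R_def B_def)
  qed
  have inj: "inj_on (\<lambda>r. (c * r) mod P) R"
  proof
    fix r s assume rs: "r \<in> R" "s \<in> R" "(c * r) mod P = (c * s) mod P"
    hence "P dvd c * (r - s)" by (simp add: mod_eq_dvd_iff right_diff_distrib)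
    hence "P dvd r - s" using False pr by (simp add: prime_elem_dvd_mult_iff)
    moreover have "r - s = 0 \<or> degree (r - s) < degree P"
      using rs degree_diff_less[of r "degree P" s] by (auto simp: R_def B_def)
    ultimately show "r = s" using dvd_imp_degree_le[of P "r - s"] by fastforce
  qed
  have "(\<lambda>r. (c * r) mod P) ` R = R"
    by (rule card_subset_eq[OF R(1)]) (use maps inj in \<open>auto simp: card_image\<close>)
  hence "(\<Prod>r\<in>R. (c * r) mod P) = \<Prod>R"
    using prod.reindex[OF inj, of "\<lambda>x. x"] by simp
  moreover have "(\<Prod>r\<in>R. (c * r) mod P) mod P = (\<Prod>r\<in>R. c * r) mod P"
    by (rule mod_prod_eq)
  ultimately have "(c ^ card R * \<Prod>R) mod P = \<Prod>R mod P"
    by (simp add: prod.distrib)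
  hence "P dvd (c ^ card R - 1) * \<Prod>R"
    by (simp add: mod_eq_dvd_iff left_diff_distrib)
  moreover have "\<not> P dvd \<Prod>S" if "finite S" "S \<subseteq> R" for S
    using that
  proof (induction S)
    case empty
    thus ?case using dP nzP by simp
  next
    case (insert r S)
    thus ?case using ndvd[of r] pr by (simp add: prime_elem_dvd_mult_iff)
  qed
  hence "\<not> P dvd \<Prod>R" using R(1) by blast
  ultimately have "P dvd c ^ card R - 1" using pr by (simp add: prime_elem_dvd_mult_iff)
  hence "P dvd c * (c ^ card R - 1)" by simp
  also have "c * (c ^ card R - 1) = c ^ ?q - c"
    using q0 R(2) by (simp add: right_diff_distrib flip: power_Suc)
  finally show ?thesis .
qed

text \<open>The case \<open>P = t\<close> of \<open>fermat_poly\<close>, applied to a constant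
  polynomial and evaluated at 0.\<close>

lemma power_card_UNIV:
  fixes a :: "'a::field"
  assumes "finite (UNIV :: 'a set)"
  shows "a ^ card (UNIV :: 'a set) = a"
proof -
  have "irreducible [:0, 1 :: 'a:]" by (rule irreducible_linear_field_poly) auto
  from fermat_poly[OF assms this, of "[:a:]"]
  have "[:0, 1:] dvd [:a:] ^ card (UNIV :: 'a set) - [:a:]" by simp
  then obtain k where "[:a:] ^ card (UNIV :: 'a set) - [:a:] = [:0, 1:] * k" by blast
  hence "poly ([:a:] ^ card (UNIV :: 'a set) - [:a:]) 0 = poly ([:0, 1:] * k) 0" by simp
  thus ?thesis by simp
qed

text \<open>Translation by 1 permutes the field, so \<open>a + 1\<close> and \<open>a\<close> have
  the same sum over all elements.\<close>

lemma of_nat_card_UNIV: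
  assumes "finite (UNIV :: 'a::field set)"
  shows "of_nat (card (UNIV :: 'a set)) = (0 :: 'a)"
proof -
  have "bij (\<lambda>a :: 'a. a + 1)" by (rule bij_plus_right)
  hence "(\<Sum>a\<in>UNIV. a + 1) = (\<Sum>a\<in>(UNIV :: 'a set). a)"
    using sum.reindex_bij_betw[of "\<lambda>a :: 'a. a + 1" UNIV UNIV "\<lambda>a. a"] by simp
  thus ?thesis by (simp add: sum.distrib)
qed

text \<open>The polynomial \<open>(1 + X) ^ q - X ^ q - 1\<close> has degree below \<open>q\<close>
  unless it is zero, but vanishes at all \<open>q\<close> field elements; so it is zero, and its
  inner coefficients are the binomial coefficients.\<close>

lemma of_nat_binomial_card_UNIV:
  assumes fin: "finite (UNIV :: 'a::field set)" and i: "0 < i" "i < card (UNIV :: 'a set)"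
  shows "of_nat (card (UNIV :: 'a set) choose i) = (0 :: 'a)"
proof -
  let ?q = "card (UNIV :: 'a set)"
  define p :: "'a poly" where "p = [:1, 1:] ^ ?q - monom 1 ?q - 1"
  have co: "coeff ([:1, 1:] ^ ?q :: 'a poly) j = of_nat (?q choose j)" for j
  proof -
    have "coeff ([:1, 1:] ^ n :: 'a poly) j = of_nat (n choose j)" for n
    proof (induction n arbitrary: j)
      case (Suc n)
      thus ?case by (cases j) (simp_all add: coeff_pCons)
    next
      case 0
      thus ?case by (cases j) auto
    qed
    thus ?thesis .
  qed
  have q0: "?q > 0" using i by simp
  have "p = 0"
  proof (rule ccontr)
    assume nz: "p \<noteq> 0"
    have "coeff p j = 0" if "j \<ge> ?q" for j
      using that q0 by (auto simp: p_def co binomial_eq_0 coeff_monom)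
    hence "degree p < ?q" using nz by (metis leading_coeff_0_iff not_less)
    moreover have "poly p a = 0" for a
      using power_card_UNIV[OF fin] by (simp add: p_def poly_monom)
    hence "?q \<le> degree p" using card_poly_roots_bound[OF nz] by simp
    ultimately show False by simp
  qed
  hence "coeff p i = 0" by simp
  thus ?thesis using i by (simp add: p_def co coeff_monom)
qed

text \<open>The homomorphism \<open>h\<close> carries the vanishing of the binomial coefficients
  from the finite field into the target ring; the case of exponent \<open>q\<close> is then
  iterated.\<close>

lemma freshman_power:
  fixes a b :: "'b::comm_ring_1" and h :: "'a::field \<Rightarrow> 'b"
  assumes fin: "finite (UNIV :: 'a set)" and h: "comm_ring_hom h"
  shows "(a + b) ^ (card (UNIV :: 'a set) ^ k) = a ^ (card (UNIV :: 'a set) ^ k) + b ^ (card (UNIV :: 'a set) ^ k)"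
proof -
  let ?q = "card (UNIV :: 'a set)"
  interpret comm_ring_hom h by fact
  have q0: "?q > 0" using fin by (simp add: card_gt_0_iff)
  have one: "(a + b) ^ ?q = a ^ ?q + b ^ ?q" for a b :: 'b
  proof -
    have "of_nat (?q choose i) * a ^ i * b ^ (?q - i) = 0" if "i \<in> {..?q} - {0, ?q}" for i
    proof -
      have "of_nat (?q choose i) = h (of_nat (?q choose i))" by (simp add: hom_distribs)
      also have "\<dots> = 0" using that of_nat_binomial_card_UNIV[OF fin, of i] by auto
      finally show ?thesis by simp
    qed
    hence "(\<Sum>i\<le>?q. of_nat (?q choose i) * a ^ i * b ^ (?q - i)) =
      (\<Sum>i\<in>{0, ?q}. of_nat (?q choose i) * a ^ i * b ^ (?q - i))"
      by (intro sum.mono_neutral_right) auto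
    thus ?thesis using q0 by (simp add: binomial_ring add.commute)
  qed
  show ?thesis
    by (induction k) (simp_all add: one power_mult mult.commute[of ?q])
qed

lemma freshman_power_sum:
  fixes f :: "'c \<Rightarrow> 'b::comm_ring_1" and h :: "'a::field \<Rightarrow> 'b"
  assumes fin: "finite (UNIV :: 'a set)" and h: "comm_ring_hom h" and "finite S"
  shows "(\<Sum>i\<in>S. f i) ^ (card (UNIV :: 'a set) ^ k) = (\<Sum>i\<in>S. f i ^ (card (UNIV :: 'a set) ^ k))"
  using assms(3)
proof induction
  case empty
  have "card (UNIV :: 'a set) > 0" using fin by (simp add: card_gt_0_iff)
  thus ?case by (simp add: power_0_left)
qed (simp add: freshman_power[OF fin h])

text \<open>With \<open>q - 1 = l * m\<close>, the polynomial \<open>X ^ m - 1\<close> has at most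
  \<open>m < q - 1\<close> roots, so it misses some nonzero \<open>a\<close>; the element sought is
  \<open>a ^ m\<close>.\<close>

lemma primitive_root_exists:
  assumes fin: "finite (UNIV :: 'a::field set)" and l: "prime l" "l dvd card (UNIV :: 'a set) - 1"
  obtains z :: "'a::field" where "z ^ l = 1" "z \<noteq> 1"
proof -
  let ?q = "card (UNIV :: 'a set)"
  have "card {0, 1 :: 'a} \<le> ?q" by (rule card_mono[OF fin]) auto
  hence q: "?q \<ge> 2" by simp
  obtain m where m: "?q - 1 = l * m" using l(2) by blast
  have m0: "m > 0" using m q by (cases m) auto
  have "m < ?q - 1" using m m0 prime_gt_1_nat[OF l(1)] by simp
  define p :: "'a poly" where "p = monom 1 m - 1"
  have "coeff p m = 1" using m0 by (simp add: p_def)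
  hence nz: "p \<noteq> 0" by auto
  have "degree p \<le> m" unfolding p_def by (intro degree_diff_le) (auto simp: degree_monom_le)
  hence "card {a. poly p a = 0} < ?q - 1"
    using poly_roots_degree[OF nz] \<open>m < ?q - 1\<close> by simp
  moreover have "card (UNIV - {0 :: 'a}) = ?q - 1" using fin by (simp add: card_Diff_singleton)
  ultimately obtain a where a: "a \<noteq> 0" "poly p a \<noteq> 0"
    using card_mono[of "{a. poly p a = 0}" "UNIV - {0}"] finite_subset[OF _ fin]
    by (metis (mono_tags, lifting) DiffD2 insertCI leD mem_Collect_eq subsetI subset_UNIV)
  have "a * a ^ (?q - 1) = a * 1" using power_card_UNIV[OF fin, of a] q by (simp flip: power_Suc)
  hence "a ^ (?q - 1) = 1" using a by simp
  hence "(a ^ m) ^ l = 1" using m by (simp add: mult.commute flip: power_mult)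
  moreover have "a ^ m \<noteq> 1" using a by (simp add: p_def poly_monom)
  ultimately show ?thesis by (rule that)
qed

text \<open>For prime \<open>l\<close> every nontrivial \<open>l\<close>-th root of unity is
  primitive: if \<open>k\<close> is coprime to \<open>l\<close>, Bezout turns
  \<open>z ^ k = 1\<close> into \<open>z = 1\<close>.\<close>

lemma primitive_root_power_eq_1:
  fixes z :: "'a::field"
  assumes "prime l" "z ^ l = 1" "z \<noteq> 1"
  shows "z ^ k = 1 \<longleftrightarrow> l dvd k"
proof
  assume k: "z ^ k = 1"
  show "l dvd k"
  proof (rule ccontr)
    assume "\<not> l dvd k"
    hence "coprime k l" using assms(1) using coprime_commute prime_imp_coprime by blast
    moreover have "k > 0" using \<open>\<not> l dvd k\<close> by (cases k) auto
    ultimately obtain a b where "k * a = l * b + 1" using bezout_nat[of k l] by auto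
    hence "z ^ (k * a) = z ^ (l * b + 1)" by simp
    hence "z = 1" using k assms by (simp add: power_add power_mult)
    thus False using assms by simp
  qed
qed (use assms in \<open>auto simp: power_mult\<close>)

text \<open>\<open>q\<close> is 0 in the field and 1 modulo \<open>l\<close>, so
  \<open>l = 0\<close> would give \<open>0 = 1\<close>. Invertibility of \<open>l\<close> serves
  both the averaging over conjugates and the discriminant.\<close>

lemma of_nat_dvd_card_UNIV_minus_1:
  assumes fin: "finite (UNIV :: 'a::field set)" and l: "l dvd card (UNIV :: 'a set) - 1"
  shows "of_nat l \<noteq> (0 :: 'a)"
proof
  assume 0: "of_nat l = (0 :: 'a)"
  have "card (UNIV :: 'a set) > 0" using fin by (simp add: card_gt_0_iff)
  moreover obtain m where "card (UNIV :: 'a set) - 1 = l * m" using l by blast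
  ultimately have "card (UNIV :: 'a set) = l * m + 1" by simp
  hence "of_nat (card (UNIV :: 'a set)) = (of_nat (l * m + 1) :: 'a)" by simp
  thus False using 0 of_nat_card_UNIV[OF fin] by simp
qed

section \<open>Integral elements\<close>

lemma emb_0 [simp]: "emb 0 = 0" and emb_1 [simp]: "emb 1 = 1"
  and emb_add: "emb (a + b) = emb a + emb b"
  and emb_mult: "emb (a * b) = emb a * emb b"
  and emb_minus: "emb (- a) = - emb a"
  by (simp_all add: emb_def fract_collapse flip: to_ac_add to_ac_mult to_ac_minus)

global_interpretation emb_hom: inj_comm_ring_hom "emb :: 'a::field poly \<Rightarrow> 'a omega"
proof
  fix p :: "'a poly"
  assume "emb p = 0"
  thus "p = 0" by (simp add: emb_def eq_fract Zero_fract_def)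
qed (simp_all add: emb_add emb_mult)

global_interpretation emb_poly_hom: map_poly_inj_comm_ring_hom "emb :: 'a::field poly \<Rightarrow> 'a omega" ..

global_interpretation emb_module: Modules.module "\<lambda>(c :: 'a::field poly) (y :: 'a omega). emb c * y"
  by standard (simp_all add: algebra_simps emb_add emb_mult)

lemma emb_in_base_field [simp]: "emb p \<in> base_field"
  by (simp add: emb_def base_field_def)

text \<open>Integrality without the ambient field of \<open>OK\<close>, so that closure properties
  can be proved in the whole algebraic closure.\<close>

definition integral :: "'a::field omega \<Rightarrow> bool" where
  "integral y \<longleftrightarrow> (\<exists>f :: 'a poly poly. lead_coeff f = 1 \<and> poly (map_poly emb f) y = 0)"

text \<open>The characteristic polynomial of the matrix of multiplication by \<open>y\<close> annihilates \<open>y\<close>.\<close>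

lemma integral_if_stable:
  fixes y :: "'a::field omega"
  assumes fin: "finite V" and v0: "v0 \<in> V" "v0 \<noteq> 0"
    and stable: "\<And>v. v \<in> V \<Longrightarrow> y * v \<in> emb_module.span V"
  shows "integral y"
proof -
  obtain vs where vs: "set vs = V" "distinct vs" using fin finite_distinct_list by blast
  define n where "n = length vs"
  have "\<forall>v\<in>V. \<exists>u. y * v = (\<Sum>w\<in>V. emb (u w) * w)"
    using stable unfolding emb_module.span_finite[OF fin] by blast
  then obtain u where u: "\<And>v. v \<in> V \<Longrightarrow> y * v = (\<Sum>w\<in>V. emb (u v w) * w)" by metis
  define M where "M = mat n n (\<lambda>(i, j). u (vs ! i) (vs ! j))"
  define b where "b = vec n (\<lambda>i. vs ! i)"
  have M: "M \<in> carrier_mat n n" by (simp add: M_def)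
  have EM: "map_mat emb M \<in> carrier_mat n n" using M by simp
  have nth: "vs ! i \<in> V" if "i < n" for i using that vs by (auto simp: n_def)
  have "map_mat emb M *\<^sub>v b = y \<cdot>\<^sub>v b"
  proof (rule eq_vecI)
    fix i assume "i < dim_vec (y \<cdot>\<^sub>v b)"
    hence i: "i < n" by (simp add: b_def)
    have "(map_mat emb M *\<^sub>v b) $ i = (\<Sum>j<n. emb (u (vs ! i) (vs ! j)) * vs ! j)"
      using i M by (simp add: M_def b_def scalar_prod_def lessThan_atLeast0)
    also have "\<dots> = (\<Sum>w\<in>V. emb (u (vs ! i) w) * w)"
      by (rule sum.reindex_bij_betw[where h = "\<lambda>j. vs ! j" and g = "\<lambda>w. emb (u (vs ! i) w) * w"])
         (use vs in \<open>auto simp: n_def intro!: bij_betw_nth\<close>)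
    also have "\<dots> = y * vs ! i" using u[OF nth[OF i]] by simp
    finally show "(map_mat emb M *\<^sub>v b) $ i = (y \<cdot>\<^sub>v b) $ i" using i by (simp add: b_def)
  qed (simp add: M_def b_def)
  moreover obtain i where "i < n" "vs ! i = v0" using v0 vs by (metis in_set_conv_nth n_def)
  hence "b $ i \<noteq> 0\<^sub>v n $ i" using v0 by (simp add: b_def)
  hence "b \<noteq> 0\<^sub>v n" by auto
  ultimately have "eigenvalue (map_mat emb M) y"
    unfolding eigenvalue_def eigenvector_def by (intro exI[of _ b]) (simp add: M_def b_def)
  hence "poly (char_poly (map_mat emb M)) y = 0" using eigenvalue_root_char_poly[OF EM] by simp
  hence "poly (map_poly emb (char_poly M)) y = 0" by (simp add: emb_hom.char_poly_hom[OF M])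
  moreover have "lead_coeff (char_poly M) = 1" using degree_monic_char_poly[OF M] by simp
  ultimately show ?thesis unfolding integral_def by blast
qed

lemma integral_power_eq:
  assumes "integral (y :: 'a::field omega)"
  obtains m c where "m > 0" "y ^ m = (\<Sum>i<m. emb (c i) * y ^ i)"
proof -
  obtain f :: "'a poly poly" where f: "lead_coeff f = 1" "poly (map_poly emb f) y = 0"
    using assms by (auto simp: integral_def)
  let ?m = "degree f"
  have d: "degree (map_poly emb f) = ?m" by simp
  have "(\<Sum>i\<le>?m. emb (coeff f i) * y ^ i) = 0"
    using f(2) unfolding poly_altdef d by simp
  hence eq: "(\<Sum>i<?m. emb (coeff f i) * y ^ i) + y ^ ?m = 0"
    using f(1) by (simp add: lessThan_Suc_atMost[symmetric])
  hence "y ^ ?m = (\<Sum>i<?m. emb (- coeff f i) * y ^ i)"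
    by (simp add: emb_minus sum_negf eq_neg_iff_add_eq_0 add.commute)
  moreover have "?m > 0" using eq by (cases "?m = 0") auto
  ultimately show ?thesis by (rule that[rotated])
qed

text \<open>The products \<open>a ^ i * b ^ j\<close> with exponents below the degrees of monic
  relations for \<open>a\<close> and \<open>b\<close> span a module stable under both, since the
  relations rewrite the first excess power. Stability passes to \<open>a + b\<close> and
  \<open>a * b\<close>, to which \<open>integral_if_stable\<close> then applies.\<close>

lemma integral_common_stable:
  assumes "integral (a :: 'a::field omega)" "integral b"
  obtains V where "finite V" "1 \<in> V"
    "\<forall>w\<in>emb_module.span V. a * w \<in> emb_module.span V"
    "\<forall>w\<in>emb_module.span V. b * w \<in> emb_module.span V"
proof -
  obtain m c where m: "m > 0" "a ^ m = (\<Sum>i<m. emb (c i) * a ^ i)"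
    using integral_power_eq[OF assms(1)] .
  obtain n d where n: "n > 0" "b ^ n = (\<Sum>i<n. emb (d i) * b ^ i)"
    using integral_power_eq[OF assms(2)] .
  define V where "V = (\<lambda>(i, j). a ^ i * b ^ j) ` ({..<m} \<times> {..<n})"
  have base: "a ^ i * b ^ j \<in> emb_module.span V" if "i < m" "j < n" for i j
    using that by (intro emb_module.span_base) (auto simp: V_def)
  have A: "a * (a ^ i * b ^ j) \<in> emb_module.span V" if "i < m" "j < n" for i j
  proof (cases "Suc i < m")
    case True thus ?thesis using base[of "Suc i" j] that by (simp add: mult_ac)
  next
    case False
    hence "Suc i = m" using that by simp
    hence "a * (a ^ i * b ^ j) = a ^ m * b ^ j" by (auto simp: mult_ac)
    also have "\<dots> = (\<Sum>i<m. emb (c i) * (a ^ i * b ^ j))"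
      by (simp add: m(2) sum_distrib_right mult.assoc)
    also have "\<dots> \<in> emb_module.span V"
      by (intro emb_module.span_sum emb_module.span_scale base) (use that in auto)
    finally show ?thesis .
  qed
  have B: "b * (a ^ i * b ^ j) \<in> emb_module.span V" if "i < m" "j < n" for i j
  proof (cases "Suc j < n")
    case True thus ?thesis using base[of i "Suc j"] that by (simp add: mult_ac)
  next
    case False
    hence "Suc j = n" using that by simp
    hence "b * (a ^ i * b ^ j) = a ^ i * b ^ n" by (auto simp: mult_ac)
    also have "\<dots> = (\<Sum>j<n. emb (d j) * (a ^ i * b ^ j))"
      by (simp add: n(2) sum_distrib_left mult.left_commute)
    also have "\<dots> \<in> emb_module.span V"
      by (intro emb_module.span_sum emb_module.span_scale base) (use that in auto)
    finally show ?thesis .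
  qed
  have stable: "y * w \<in> emb_module.span V"
    if "\<And>v. v \<in> V \<Longrightarrow> y * v \<in> emb_module.span V" "w \<in> emb_module.span V" for y w
    using that(2)
  proof (induction rule: emb_module.span_induct_alt)
    case base thus ?case by (simp add: emb_module.span_zero)
  next
    case (step k v z)
    have "y * (emb k * v + z) = emb k * (y * v) + y * z" by (simp add: algebra_simps)
    thus ?case using step that(1) by (simp add: emb_module.span_add emb_module.span_scale)
  qed
  have Vc: "\<exists>i<m. \<exists>j<n. v = a ^ i * b ^ j" if "v \<in> V" for v
    using that by (auto simp: V_def)
  show ?thesis
  proof (rule that[of V])
    show "finite V" by (simp add: V_def)
    show "1 \<in> V" using m(1) n(1) by (auto simp: V_def intro!: image_eqI[of _ _ "(0, 0)"])
    show "\<forall>w\<in>emb_module.span V. a * w \<in> emb_module.span V"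
      using A Vc by (intro ballI, elim stable[rotated]) metis
    show "\<forall>w\<in>emb_module.span V. b * w \<in> emb_module.span V"
      using B Vc by (intro ballI, elim stable[rotated]) metis
  qed
qed

lemma integral_add:
  assumes "integral a" "integral b" shows "integral (a + b)"
proof -
  obtain V where V: "finite V" "1 \<in> V"
    "\<forall>w\<in>emb_module.span V. a * w \<in> emb_module.span V"
    "\<forall>w\<in>emb_module.span V. b * w \<in> emb_module.span V"
    using integral_common_stable[OF assms] by blast
  show ?thesis
    by (rule integral_if_stable[OF V(1,2)])
       (simp_all add: distrib_right emb_module.span_add V(3,4) emb_module.span_base)
qed

lemma integral_mult:
  assumes "integral a" "integral b" shows "integral (a * b)"
proof -
  obtain V where V: "finite V" "1 \<in> V"
    "\<forall>w\<in>emb_module.span V. a * w \<in> emb_module.span V"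
    "\<forall>w\<in>emb_module.span V. b * w \<in> emb_module.span V"
    using integral_common_stable[OF assms] by blast
  show ?thesis
    by (rule integral_if_stable[OF V(1,2)])
       (simp_all add: mult.assoc V(3,4) emb_module.span_base)
qed

lemma integral_emb [simp]: "integral (emb p)"
  unfolding integral_def by (intro exI[of _ "[:- p, 1:]"]) (simp add: emb_minus)

lemma integral_0 [simp]: "integral 0" and integral_1 [simp]: "integral 1"
  using integral_emb[of 0] integral_emb[of 1] by simp_all

lemma integral_uminus: "integral a \<Longrightarrow> integral (- a)"
  using integral_mult[OF integral_emb[of "-1"], of a] by (simp add: emb_minus)

lemma integral_sum: "(\<And>i. i \<in> S \<Longrightarrow> integral (f i)) \<Longrightarrow> integral (\<Sum>i\<in>S. f i)"
  by (induction S rule: infinite_finite_induct) (auto intro: integral_add)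

lemma integral_power: "integral a \<Longrightarrow> integral (a ^ n)"
  by (induction n) (auto intro: integral_mult)

lemma integral_root:
  assumes "x ^ n = emb D" "n > 0" shows "integral x"
  unfolding integral_def
proof (intro exI conjI)
  have "degree (monom 1 n - [:D:]) = n"
    using assms(2) by (intro antisym degree_diff_le le_degree) (auto simp: degree_monom_le coeff_pCons split: nat.splits)
  thus "lead_coeff (monom 1 n - [:D:]) = 1" using assms(2) by (simp add: coeff_pCons split: nat.splits)
  show "poly (map_poly emb (monom 1 n - [:D:])) x = 0"
    using assms by (simp add: emb_poly_hom.hom_minus poly_monom emb_hom.map_poly_pCons_hom)
qed

text \<open>The polynomial ring is integrally closed, by the rational root argument: after clearing
  denominators every lower term keeps a factor \<open>v\<close>, so \<open>v\<close> divides
  \<open>u ^ m\<close>, and in a reduced fraction \<open>v\<close> then has no prime factor.\<close>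

lemma integral_in_base_field:
  assumes "integral y" "y \<in> base_field"
  obtains w where "y = emb w"
proof -
  obtain z where z: "y = to_ac z" using assms(2) by (auto simp: base_field_def)
  obtain u v where uv: "v \<noteq> 0" "z = Fract u v"
    and red: "\<And>P. prime_elem P \<Longrightarrow> P dvd v \<Longrightarrow> \<not> P dvd u"
    using reduced_fraction_exists[of z] by blast
  obtain m c where m: "m > 0" "y ^ m = (\<Sum>i<m. emb (c i) * y ^ i)"
    using integral_power_eq[OF assms(1)] .
  have yv: "y * emb v = emb u" using z uv by (simp add: emb_def eq_fract flip: to_ac_mult)
  have pw: "y ^ i * emb v ^ m = emb (u ^ i * v ^ (m - i))" if "i \<le> m" for i
  proof -
    have "emb v ^ m = emb v ^ i * emb v ^ (m - i)" using that by (simp flip: power_add)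
    hence "y ^ i * emb v ^ m = (y * emb v) ^ i * emb v ^ (m - i)" by (simp add: power_mult_distrib)
    thus ?thesis by (simp add: yv emb_mult emb_hom.hom_power)
  qed
  have "emb (u ^ m) = y ^ m * emb v ^ m" using pw[of m] by simp
  also have "\<dots> = (\<Sum>i<m. emb (c i) * (y ^ i * emb v ^ m))"
    by (simp add: m(2) sum_distrib_right mult.assoc)
  also have "\<dots> = emb (\<Sum>i<m. c i * (u ^ i * v ^ (m - i)))"
    by (simp add: emb_hom.hom_sum pw flip: emb_mult)
  finally have "u ^ m = (\<Sum>i<m. c i * (u ^ i * v ^ (m - i)))" by simp
  moreover have "v dvd (\<Sum>i<m. c i * (u ^ i * v ^ (m - i)))"
    by (intro dvd_sum dvd_mult) (auto intro: dvd_power)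
  ultimately have vd: "v dvd u ^ m" by simp
  have "\<not> P dvd v" if "prime_elem P" for P
    using red[OF that] vd prime_elem_dvd_power[OF that] dvd_trans by blast
  from reduced_fraction_unit[OF uv(1) this] obtain w where "Fract u v = Fract w 1" .
  thus ?thesis using z uv that[of w] by (simp add: emb_def)
qed

section \<open>Kummer extensions\<close>

global_interpretation to_ac_hom: inj_comm_ring_hom "to_ac :: 'a::field \<Rightarrow> 'a alg_closure"
  by standard simp_all

global_interpretation to_ac_poly_hom: map_poly_inj_comm_ring_hom "to_ac :: 'a::field \<Rightarrow> 'a alg_closure" ..

lemma base_field_0 [simp]: "0 \<in> base_field" and base_field_1 [simp]: "1 \<in> base_field"
  unfolding base_field_def by (metis rangeI to_ac_0, metis rangeI to_ac_1)

lemma base_field_add: "a \<in> base_field \<Longrightarrow> b \<in> base_field \<Longrightarrow> a + b \<in> base_field"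
  and base_field_diff: "a \<in> base_field \<Longrightarrow> b \<in> base_field \<Longrightarrow> a - b \<in> base_field"
  and base_field_mult: "a \<in> base_field \<Longrightarrow> b \<in> base_field \<Longrightarrow> a * b \<in> base_field"
  and base_field_divide: "a \<in> base_field \<Longrightarrow> b \<in> base_field \<Longrightarrow> a / b \<in> base_field"
  unfolding base_field_def by (auto simp flip: to_ac_add to_ac_diff to_ac_mult to_ac_divide)

lemma base_field_sum: "(\<And>i. i \<in> S \<Longrightarrow> f i \<in> base_field) \<Longrightarrow> (\<Sum>i\<in>S. f i) \<in> base_field"
  by (induction S rule: infinite_finite_induct) (auto intro: base_field_add)

lemma base_field_quotient:
  assumes "y \<in> base_field"
  obtains u v where "v \<noteq> 0" "y * emb v = emb u"
proof -
  obtain w where w: "y = to_ac w" using assms by (auto simp: base_field_def)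
  obtain u v where "v \<noteq> 0" "w = Fract u v" by (cases w) auto
  thus ?thesis using that[of v u] w by (simp add: emb_def eq_fract flip: to_ac_mult)
qed

lemma common_denominator:
  assumes "finite S" "\<And>i. i \<in> S \<Longrightarrow> f i \<in> base_field"
  shows "\<exists>d u. d \<noteq> 0 \<and> (\<forall>i\<in>S. f i * emb d = emb (u i))"
  using assms
proof (induction S)
  case empty
  show ?case by (intro exI[of _ 1]) simp
next
  case (insert j S)
  then obtain d u where du: "d \<noteq> 0" "\<And>i. i \<in> S \<Longrightarrow> f i * emb d = emb (u i)" by auto
  obtain w v where wv: "v \<noteq> 0" "f j * emb v = emb w" using base_field_quotient insert.prems by blast
  have "f i * emb (d * v) = emb ((\<lambda>i. if i = j then w * d else u i * v) i)" if "i \<in> insert j S" for i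
  proof (cases "i = j")
    case True
    have "f j * emb (d * v) = (f j * emb v) * emb d" by (simp add: emb_mult)
    thus ?thesis using True wv(2) by (simp add: emb_mult)
  next
    case False
    have "f i * emb (d * v) = (f i * emb d) * emb v" by (simp add: emb_mult)
    thus ?thesis using False that du(2)[of i] by (simp add: emb_mult)
  qed
  thus ?case using du(1) wv(1) by (intro exI[of _ "d * v"] exI[of _ "\<lambda>i. if i = j then w * d else u i * v"]) auto
qed

text \<open>Since \<open>l\<close> is prime, \<open>z\<close> is a primitive \<open>l\<close>-th
  root of unity. The element \<open>x\<close> is an arbitrary root of \<open>X ^ l - D\<close>, so
  the locale can also be instantiated for a second root inside the same field.\<close>

locale kummer =
  fixes l :: nat and z :: "'a::field" and D :: "'a poly" and x :: "'a omega"
  assumes fin: "finite (UNIV :: 'a set)" and prime_l: "prime l"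
    and l_dvd: "l dvd card (UNIV :: 'a set) - 1"
    and z_root: "z ^ l = 1" and z_ne: "z \<noteq> 1"
    and sqf: "squarefree D" and deg_D: "degree D > 0"
    and x_root: "x ^ l = emb D"
begin

lemma l_gt_1: "l > 1" using prime_l by (rule prime_gt_1_nat)

lemma D_nz: "D \<noteq> 0" using deg_D by auto

lemma integral_x: "integral x" using x_root l_gt_1 by (intro integral_root) auto

text \<open>Eisenstein's criterion: multiplying the relation by a power of \<open>x\<close> shows that
  \<open>emb (c j) * x ^ (l - 1)\<close> is \<open>P\<close> times an integral element; taking \<open>l\<close>-th powers yields
  a divisibility between polynomials.\<close>

lemma relation_dvd:
  assumes rel: "(\<Sum>i<l. emb (c i) * x ^ i) = 0" and P: "prime_elem P" "P dvd D"
  shows "j < l \<Longrightarrow> P dvd c j"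
proof (induction j rule: less_induct)
  case (less j)
  obtain E where E: "D = P * E" using P by blast
  have "\<forall>i. \<exists>e. i < j \<longrightarrow> c i = P * e" using less by (metis dvdE less_trans)
  then obtain e where e: "\<And>i. i < j \<Longrightarrow> c i = P * e i" by metis
  \<comment> \<open>The shift moves term \<open>j\<close> to exponent \<open>l - 1\<close>. Earlier
    terms have coefficients divisible by \<open>P\<close> by induction; later ones reach exponent at
    least \<open>l\<close> and pick up \<open>x ^ l = P * E\<close>. What remains after removing
    \<open>P\<close> is \<open>w i\<close>.\<close>
  let ?k = "l - 1 - j"
  define w where "w i = (if i < j then emb (e i) * x ^ (i + ?k) else emb (c i * E) * x ^ (i - j - 1))" for i
  have w: "emb (c i) * x ^ (i + ?k) = emb P * w i" if "i < l" "i \<noteq> j" for i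
  proof (cases "i < j")
    case True
    thus ?thesis using e[OF True] by (simp add: w_def emb_mult)
  next
    case False
    hence "i + ?k = l + (i - j - 1)" using that less.prems by simp
    hence "x ^ (i + ?k) = emb P * emb E * x ^ (i - j - 1)"
      by (simp add: power_add x_root E emb_mult)
    thus ?thesis using False by (simp add: w_def emb_mult)
  qed
  have "0 = (\<Sum>i<l. emb (c i) * x ^ i) * x ^ ?k" using rel by simp
  also have "\<dots> = (\<Sum>i<l. emb (c i) * x ^ (i + ?k))"
    by (simp add: sum_distrib_right power_add mult.assoc)
  also have "\<dots> = emb (c j) * x ^ (j + ?k) + (\<Sum>i\<in>{..<l} - {j}. emb (c i) * x ^ (i + ?k))"
    using less.prems by (intro sum.remove) auto
  also have "(\<Sum>i\<in>{..<l} - {j}. emb (c i) * x ^ (i + ?k)) = emb P * (\<Sum>i\<in>{..<l} - {j}. w i)"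
    unfolding sum_distrib_left by (intro sum.cong refl w) auto
  also have "j + ?k = l - 1" using less.prems by simp
  finally have eq: "emb (c j) * x ^ (l - 1) = emb P * - (\<Sum>i\<in>{..<l} - {j}. w i)"
    by (simp add: eq_neg_iff_add_eq_0)
  define y where "y = - (\<Sum>i\<in>{..<l} - {j}. w i)"
  have "integral (w i)" for i
    by (auto simp: w_def intro!: integral_mult integral_power integral_x simp del: emb_mult)
  hence "integral y" unfolding y_def by (intro integral_uminus integral_sum)
  hence int: "integral (y ^ l)" by (rule integral_power)
  have "(emb (c j) * x ^ (l - 1)) ^ l = (emb P * y) ^ l" by (simp only: eq y_def)
  moreover have "(x ^ (l - 1)) ^ l = emb D ^ (l - 1)"
    by (metis x_root power_mult mult.commute)
  ultimately have yl: "emb (c j ^ l * D ^ (l - 1)) = emb (P ^ l) * y ^ l"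
    by (simp add: power_mult_distrib emb_mult emb_hom.hom_power)
  have Pnz: "P \<noteq> 0" using P by auto
  hence "y ^ l = emb (c j ^ l * D ^ (l - 1)) / emb (P ^ l)" using yl by simp
  hence "y ^ l \<in> base_field" by (simp add: base_field_divide)
  then obtain a where "y ^ l = emb a" using integral_in_base_field[OF int] by blast
  hence "emb (c j ^ l * D ^ (l - 1)) = emb (P ^ l * a)" using yl by (simp only: emb_mult)
  hence "c j ^ l * D ^ (l - 1) = P ^ l * a" by simp
  hence "P ^ l dvd c j ^ l * D ^ (l - 1)" by simp
  thus ?case using prime_elem_dvd_of_power_dvd[OF P(1) sqf, of "l - 1" l] l_gt_1 by simp
qed

text \<open>Infinite descent: dividing all coefficients by a prime factor \<open>P\<close> of
  \<open>D\<close> gives another relation, so every power of \<open>P\<close> divides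
  \<open>c j\<close>, which its degree allows only for 0.\<close>

lemma relation_trivial:
  assumes rel: "(\<Sum>i<l. emb (c i) * x ^ i) = 0" and j: "j < l"
  shows "c j = 0"
proof -
  obtain P where P: "irreducible P" "P dvd D" using irreducible_factor_exists[OF deg_D] by blast
  have pr: "prime_elem P" using P(1) by (rule field_poly_irreducible_imp_prime)
  have nzP: "P \<noteq> 0" using pr by auto
  have dP: "degree P > 0" using P nzP by (auto simp: irreducible_def is_unit_iff_degree)
  have *: "P ^ n dvd c j" if "(\<Sum>i<l. emb (c i) * x ^ i) = 0" "j < l" for n c j
    using that
  proof (induction n arbitrary: c j)
    case (Suc n)
    have "\<forall>i. \<exists>e. i < l \<longrightarrow> c i = P * e" using relation_dvd[OF Suc.prems(1) pr P(2)] by (metis dvdE)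
    then obtain e where e: "\<And>i. i < l \<Longrightarrow> c i = P * e i" by metis
    have "emb P * (\<Sum>i<l. emb (e i) * x ^ i) = (\<Sum>i<l. emb (c i) * x ^ i)"
      unfolding sum_distrib_left
    proof (intro sum.cong refl)
      fix i assume "i \<in> {..<l}"
      hence "c i = P * e i" using e by blast
      thus "emb P * (emb (e i) * x ^ i) = emb (c i) * x ^ i" by (simp only: emb_mult mult.assoc)
    qed
    hence "(\<Sum>i<l. emb (e i) * x ^ i) = 0" using Suc.prems nzP by simp
    hence "P ^ n dvd e j" using Suc.IH Suc.prems by blast
    thus ?case using e[OF Suc.prems(2)] by (simp add: mult_dvd_mono)
  qed simp
  show ?thesis
  proof (rule ccontr)
    assume nz: "c j \<noteq> 0"
    have "degree (P ^ Suc (degree (c j))) \<le> degree (c j)"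
      using *[OF rel j] nz by (rule dvd_imp_degree_le)
    moreover have "degree (P ^ Suc (degree (c j))) = Suc (degree (c j)) * degree P"
      by (rule Polynomial.degree_power_eq[OF nzP])
    moreover have "Suc (degree (c j)) * degree P \<ge> Suc (degree (c j)) * 1"
      using dP by (intro mult_le_mono) auto
    ultimately show False by simp
  qed
qed

text \<open>Clearing denominators reduces this to polynomial coefficients. The independence takes
  the place of irreducibility of \<open>X ^ l - D\<close>.\<close>

lemma powers_independent:
  assumes c: "\<And>i. i < l \<Longrightarrow> c i \<in> base_field" and rel: "(\<Sum>i<l. c i * x ^ i) = 0" and j: "j < l"
  shows "c j = 0"
proof -
  obtain d u where du: "d \<noteq> 0" "\<forall>i\<in>{..<l}. c i * emb d = emb (u i)"
    using common_denominator[of "{..<l}" c] c by auto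
  have "(\<Sum>i<l. emb (u i) * x ^ i) = (\<Sum>i<l. c i * x ^ i) * emb d"
    unfolding sum_distrib_right
  proof (intro sum.cong refl)
    fix i assume "i \<in> {..<l}"
    hence "emb (u i) = c i * emb d" using du(2) by simp
    thus "emb (u i) * x ^ i = c i * x ^ i * emb d" by simp
  qed
  hence "u j = 0" using relation_trivial[OF _ j, of u] rel by simp
  hence "c j * emb d = 0" using du(2) j by simp
  thus ?thesis using du(1) by simp
qed

section \<open>The field generated by \<open>x\<close>\<close>

definition ev :: "'a poly fract poly \<Rightarrow> 'a omega \<Rightarrow> 'a omega" where
  "ev p y = poly (map_poly to_ac p) y"

definition K :: "'a omega set" where "K = range (\<lambda>p. ev p x)"

lemma ev_add [simp]: "ev (p + r) y = ev p y + ev r y"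
  and ev_mult [simp]: "ev (p * r) y = ev p y * ev r y"
  and ev_minus [simp]: "ev (- p) y = - ev p y"
  and ev_diff [simp]: "ev (p - r) y = ev p y - ev r y"
  and ev_0 [simp]: "ev 0 y = 0" and ev_1 [simp]: "ev 1 y = 1"
  and ev_const [simp]: "ev [:c:] y = to_ac c"
  and ev_monom [simp]: "ev (monom c n) y = to_ac c * y ^ n"
  by (simp_all add: ev_def to_ac_poly_hom.hom_add to_ac_poly_hom.hom_mult to_ac_poly_hom.hom_minus
        to_ac_poly_hom.hom_uminus poly_monom to_ac_hom.map_poly_pCons_hom)

lemma ev_pcompose_monom: "ev (pcompose p (monom c 1)) y = ev p (to_ac c * y)"
  by (induction p) (simp_all add: pcompose_pCons, simp add: ev_def to_ac_hom.map_poly_pCons_hom)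

lemma ev_sum: "ev p y = (\<Sum>i<n. to_ac (coeff p i) * y ^ i)" if "p = 0 \<or> degree p < n"
proof -
  have "ev p y = (\<Sum>i\<le>degree p. to_ac (coeff p i) * y ^ i)" by (simp add: ev_def poly_altdef)
  also have "\<dots> = (\<Sum>i<n. to_ac (coeff p i) * y ^ i)" if "degree p < n"
    using that by (intro sum.mono_neutral_left) (auto simp: coeff_eq_0)
  finally show ?thesis using that by (cases "p = 0") auto
qed

lemma ev_x_eq_0_degree_less:
  assumes "ev p x = 0" "degree p < l" shows "p = 0"
proof (rule poly_eqI)
  fix i
  have "(\<Sum>i<l. to_ac (coeff p i) * x ^ i) = 0" using assms ev_sum[of p l] by simp
  from powers_independent[OF _ this, of i] show "coeff p i = coeff 0 i"
    using assms(2) by (cases "i < l") (auto simp: base_field_def coeff_eq_0)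
qed

definition min_poly :: "'a poly fract poly" where "min_poly = monom 1 l - [:Fract D 1:]"

lemma degree_min_poly: "degree min_poly = l"
  using l_gt_1 unfolding min_poly_def
  by (intro antisym degree_diff_le le_degree) (auto simp: degree_monom_le coeff_pCons split: nat.splits)

lemma min_poly_nz: "min_poly \<noteq> 0" using degree_min_poly l_gt_1 by auto

lemma ev_min_poly: "y ^ l = emb D \<Longrightarrow> ev min_poly y = 0"
  by (simp add: min_poly_def emb_def)

lemma degree_mod_min_poly: "degree (p mod min_poly) < l"
  using degree_mod_less[OF min_poly_nz, of p] degree_min_poly l_gt_1 by auto

lemma ev_mod_min_poly:
  assumes "y ^ l = emb D" shows "ev (p mod min_poly) y = ev p y"
proof -
  have "ev p y = ev (min_poly * (p div min_poly) + p mod min_poly) y" by simp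
  also have "\<dots> = ev (p mod min_poly) y" by (simp only: ev_add ev_mult ev_min_poly[OF assms] mult_zero_left add_0_left)
  finally show ?thesis by simp
qed

text \<open>Evaluation at a conjugate is well defined on values at \<open>x\<close>: the difference
  of two representatives reduces to 0 modulo \<open>min_poly\<close>, which also vanishes at
  \<open>y\<close>.\<close>

lemma ev_conjugate_eq:
  assumes "ev p x = ev r x" "y ^ l = emb D" shows "ev p y = ev r y"
proof -
  have "ev ((p - r) mod min_poly) x = 0" using ev_mod_min_poly[OF x_root] assms(1) by simp
  hence "(p - r) mod min_poly = 0" using ev_x_eq_0_degree_less degree_mod_min_poly by blast
  hence "ev (p - r) y = 0" using ev_mod_min_poly[OF assms(2), of "p - r"] by simp
  thus ?thesis by simp
qed

lemma K_I: "ev p x \<in> K" by (simp add: K_def)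

lemma K_E: assumes "y \<in> K" obtains c where "\<And>i. c i \<in> base_field" "y = (\<Sum>i<l. c i * x ^ i)"
proof -
  obtain p where "y = ev p x" using assms by (auto simp: K_def)
  hence "y = ev (p mod min_poly) x" by (simp add: ev_mod_min_poly x_root)
  thus ?thesis using ev_sum[of "p mod min_poly" l x] degree_mod_min_poly[of p]
    by (intro that[of "\<lambda>i. to_ac (coeff (p mod min_poly) i)"]) (auto simp: base_field_def)
qed

text \<open>Euclidean descent: with \<open>min_poly = p * s + r\<close>, the value of
  \<open>r\<close> at \<open>x\<close> is a multiple of that of \<open>p\<close>, so inverting the
  former inverts the latter. If \<open>r\<close> were 0, then \<open>p\<close> or \<open>s\<close>
  would be a nonzero polynomial of degree below \<open>l\<close> vanishing at
  \<open>x\<close>.\<close>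

lemma ev_inverse:
  assumes "p \<noteq> 0" "degree p < l" shows "\<exists>r. ev r x * ev p x = 1"
  using assms
proof (induction "degree p" arbitrary: p rule: less_induct)
  case less
  show ?case
  proof (cases "degree p = 0")
    case True
    then obtain c where "p = [:c:]" by (rule degree_eq_zeroE)
    thus ?thesis using less.prems by (intro exI[of _ "[:inverse c:]"]) (simp flip: to_ac_mult)
  next
    case False
    let ?s = "min_poly div p" and ?r = "min_poly mod p"
    have eq: "ev p x * ev ?s x + ev ?r x = 0"
    proof -
      have "ev (p * ?s + ?r) x = 0" by (simp only: mult_div_mod_eq ev_min_poly[OF x_root])
      thus ?thesis by (simp only: ev_add ev_mult)
    qed
    have lt: "?r = 0 \<or> degree ?r < degree p" using degree_mod_less[OF less.prems(1)] by blast
    have "?r \<noteq> 0"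
    proof
      assume r: "?r = 0"
      hence m: "min_poly = p * ?s" by (metis add.right_neutral mult_div_mod_eq)
      hence s: "?s \<noteq> 0" using min_poly_nz by auto
      have "degree min_poly = degree p + degree ?s"
        using m s less.prems(1) by (metis degree_mult_eq)
      hence "degree ?s < l" using False degree_min_poly by simp
      moreover have "ev p x = 0 \<or> ev ?s x = 0" using eq r by simp
      ultimately show False using ev_x_eq_0_degree_less s less.prems by blast
    qed
    then obtain r' where r': "ev r' x * ev ?r x = 1" using less.hyps lt less.prems(2) by force
    have "ev ?r x = - (ev p x * ev ?s x)" using eq by (simp add: eq_neg_iff_add_eq_0 add.commute)
    hence "ev (- (r' * ?s)) x * ev p x = 1" using r' by (simp add: mult_ac)
    thus ?thesis by blast
  qed
qed

lemma base_field_subset_K: "base_field \<subseteq> K"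
proof
  fix y assume "y \<in> (base_field :: 'a omega set)"
  then obtain c where "y = ev [:c:] x" by (auto simp: base_field_def)
  thus "y \<in> K" by (simp only: K_I)
qed

lemma x_in_K: "x \<in> K" using K_I[of "monom 1 1"] by simp

lemma K_add: "a \<in> K \<Longrightarrow> b \<in> K \<Longrightarrow> a + b \<in> K"
  and K_mult: "a \<in> K \<Longrightarrow> b \<in> K \<Longrightarrow> a * b \<in> K"
  and K_minus: "a \<in> K \<Longrightarrow> - a \<in> K"
  unfolding K_def by (auto simp flip: ev_add ev_mult ev_minus)

lemma K_sum: "(\<And>i. i \<in> S \<Longrightarrow> f i \<in> K) \<Longrightarrow> (\<Sum>i\<in>S. f i) \<in> K"
  using base_field_subset_K by (induction S rule: infinite_finite_induct) (auto intro: K_add)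

lemma K_power: "a \<in> K \<Longrightarrow> a ^ n \<in> K"
  using base_field_subset_K by (induction n) (auto intro: K_mult)

lemma K_is_subfield: "is_subfield K"
  unfolding is_subfield_def
proof (intro conjI ballI impI)
  fix y assume y: "y \<in> K" "y \<noteq> 0"
  then obtain p where "y = ev p x" by (auto simp: K_def)
  hence p: "y = ev (p mod min_poly) x" by (simp add: ev_mod_min_poly x_root)
  hence "p mod min_poly \<noteq> 0" using y by auto
  then obtain r where "ev r x * y = 1" using ev_inverse degree_mod_min_poly p by blast
  hence "inverse y = ev r x" using y by (simp add: field_simps inverse_unique mult.commute)
  thus "inverse y \<in> K" by (simp add: K_I)
qed (use base_field_subset_K in \<open>auto intro: K_add K_mult K_minus\<close>)

lemma powers_coeff_unique:
  assumes "\<And>i. i < l \<Longrightarrow> c i \<in> base_field" "\<And>i. i < l \<Longrightarrow> d i \<in> base_field"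
    "(\<Sum>i<l. c i * x ^ i) = (\<Sum>i<l. d i * x ^ i)" "j < l"
  shows "c j = d j"
proof -
  have "(\<Sum>i<l. (c i - d i) * x ^ i) = 0" using assms(3) by (simp add: left_diff_distrib sum_subtractf)
  from powers_independent[OF _ this assms(4)] show ?thesis
    using assms(1,2) by (simp add: base_field_diff)
qed

lemma basis_powers: "is_basis K l (\<lambda>i. x ^ i)"
  unfolding is_basis_def
proof (intro conjI ballI allI impI)
  fix y assume "y \<in> K"
  then obtain c where c: "\<And>i. c i \<in> base_field" "y = (\<Sum>i<l. c i * x ^ i)" using K_E by metis
  \<comment> \<open>Cut off at \<open>l\<close>, because \<open>is_basis\<close> gets uniqueness by
    requiring the coordinates from \<open>n\<close> on to be 0.\<close>
  let ?c = "\<lambda>i. if i < l then c i else 0"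
  show "\<exists>!c. (\<forall>i<l. c i \<in> base_field) \<and> (\<forall>i\<ge>l. c i = 0) \<and> y = (\<Sum>i<l. c i * x ^ i)"
  proof (rule ex1I[of _ ?c])
    fix d assume d: "(\<forall>i<l. d i \<in> base_field) \<and> (\<forall>i\<ge>l. d i = 0) \<and> y = (\<Sum>i<l. d i * x ^ i)"
    show "d = ?c"
    proof
      fix j show "d j = ?c j" using d c powers_coeff_unique[of d c j] by auto
    qed
  qed (use c in auto)
qed (simp add: K_power x_in_K)

end

section \<open>Roots of unity and the Galois group\<close>

lemma emb_const_power: "emb [:c ^ k:] = emb [:c:] ^ k"
  by (simp add: poly_const_pow flip: emb_hom.hom_power)

lemma of_nat_eq_emb: "of_nat n = emb [:of_nat n:]"
  by (metis emb_hom.hom_of_nat of_nat_poly)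

context kummer
begin

definition zeta :: "'a omega" where "zeta = emb [:z:]"

lemma zeta_power_eq_1: "zeta ^ k = 1 \<longleftrightarrow> l dvd k"
proof -
  have "zeta ^ k = 1 \<longleftrightarrow> emb [:z ^ k:] = emb [:1:]"
    by (simp add: zeta_def emb_const_power flip: one_pCons)
  also have "\<dots> \<longleftrightarrow> z ^ k = 1" by (simp only: emb_hom.eq_iff pCons_eq_iff simp_thms)
  finally show ?thesis using primitive_root_power_eq_1[OF prime_l z_root z_ne] by simp
qed

lemma zeta_nz: "zeta \<noteq> 0"
  using z_root l_gt_1 by (auto simp: zeta_def power_0_left)

lemma zeta_power_in_base_field [simp]: "zeta ^ k \<in> base_field"
  by (simp add: zeta_def flip: emb_const_power)

lemma zeta_power_inj: "inj_on (\<lambda>k. zeta ^ k) {..<l}"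
proof (rule linorder_inj_onI)
  fix i j assume ij: "i < j" "i \<in> {..<l}" "j \<in> {..<l}"
  show "zeta ^ i \<noteq> zeta ^ j"
  proof
    assume eq: "zeta ^ i = zeta ^ j"
    have "zeta ^ j = zeta ^ i * zeta ^ (j - i)" using ij by (simp flip: power_add)
    hence "zeta ^ (j - i) = 1" using eq zeta_nz by simp
    hence "l dvd j - i" by (simp add: zeta_power_eq_1)
    thus False using ij by (auto dest: dvd_imp_le)
  qed
qed auto

lemma x_nz: "x \<noteq> 0" using x_root D_nz l_gt_1 by (auto simp: power_0_left)

lemma conjugate_root: "(zeta ^ k * x) ^ l = emb D"
proof -
  have "(zeta ^ k) ^ l = 1" by (metis dvd_triv_right power_mult zeta_power_eq_1)
  thus ?thesis by (simp add: power_mult_distrib x_root)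
qed

text \<open>The quotient \<open>y / x\<close> is a root of \<open>X ^ l - 1\<close>, and the
  \<open>l\<close> distinct powers of \<open>zeta\<close> already exhaust these roots.\<close>

lemma root_is_conjugate:
  assumes "y ^ l = emb D" obtains k where "k < l" "y = zeta ^ k * x"
proof -
  let ?p = "monom 1 l - 1 :: 'a omega poly"
  have "coeff ?p l = 1" using l_gt_1 by simp
  hence nz: "?p \<noteq> 0" by (metis coeff_0 zero_neq_one)
  have "degree ?p \<le> l" by (intro degree_diff_le) (auto simp: degree_monom_le)
  hence le: "card {w. poly ?p w = 0} \<le> l" using poly_roots_degree[OF nz] by simp
  have sub: "(\<lambda>k. zeta ^ k) ` {..<l} \<subseteq> {w. poly ?p w = 0}"
    by (auto simp: poly_monom zeta_power_eq_1 simp flip: power_mult)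
  have "(\<lambda>k. zeta ^ k) ` {..<l} = {w. poly ?p w = 0}"
  proof (rule card_seteq[OF poly_roots_finite[OF nz] sub])
    show "card {w. poly ?p w = 0} \<le> card ((\<lambda>k. zeta ^ k) ` {..<l})"
      using le by (simp add: card_image[OF zeta_power_inj])
  qed
  moreover have "y / x \<in> {w. poly ?p w = 0}"
    using assms x_root x_nz D_nz by (simp add: poly_monom power_divide)
  ultimately obtain k where "k < l" "y / x = zeta ^ k" by auto
  thus ?thesis using that[of k] x_nz by (simp add: field_simps)
qed

text \<open>By \<open>ev_conjugate_eq\<close> the choice of \<open>p\<close> does not affect the
  value. Outside \<open>K\<close> it is the identity, matching the convention in
  \<open>gal\<close>.\<close>

definition sigma :: "nat \<Rightarrow> 'a omega \<Rightarrow> 'a omega" where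
  "sigma k y = (if y \<in> K then ev (SOME p. ev p x = y) (zeta ^ k * x) else y)"

lemma sigma_ev: "sigma k (ev p x) = ev p (zeta ^ k * x)"
proof -
  have "ev (SOME r. ev r x = ev p x) x = ev p x" by (rule someI) simp
  from ev_conjugate_eq[OF this conjugate_root] show ?thesis by (simp add: sigma_def K_I)
qed

lemma sigma_outside: "y \<notin> K \<Longrightarrow> sigma k y = y" by (simp add: sigma_def)

lemma sigma_add: "a \<in> K \<Longrightarrow> b \<in> K \<Longrightarrow> sigma k (a + b) = sigma k a + sigma k b"
  and sigma_mult: "a \<in> K \<Longrightarrow> b \<in> K \<Longrightarrow> sigma k (a * b) = sigma k a * sigma k b"
  unfolding K_def by (auto simp: sigma_ev simp flip: ev_add ev_mult)

lemma sigma_base_field: "y \<in> base_field \<Longrightarrow> sigma k y = y"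
  using sigma_ev[of k "[:c:]" for c] by (auto simp: base_field_def)

lemma sigma_x: "sigma k x = zeta ^ k * x"
  using sigma_ev[of k "monom 1 1"] by simp

text \<open>As \<open>zeta ^ k\<close> lies in the base field, a value at
  \<open>zeta ^ k * x\<close> is also the value at \<open>x\<close> of a rescaled polynomial. This
  keeps \<open>sigma k\<close> inside \<open>K\<close> and lets such maps be composed.\<close>

lemma sigma_ev_pcompose: "sigma k (ev p x) = ev (pcompose p (monom (Fract [:z ^ k:] 1) 1)) x"
  by (simp only: sigma_ev ev_pcompose_monom flip: emb_def) (simp add: emb_const_power zeta_def)

lemma sigma_in_K: "y \<in> K \<Longrightarrow> sigma k y \<in> K"
  by (metis K_I K_def imageE sigma_ev_pcompose)

lemma sigma_sigma: "sigma j (sigma k y) = sigma (j + k) y"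
proof (cases "y \<in> K")
  case True
  then obtain p where "y = ev p x" by (auto simp: K_def)
  hence "sigma k y = ev (pcompose p (monom (Fract [:z ^ k:] 1) 1)) x"
    by (simp only: sigma_ev_pcompose)
  hence "sigma j (sigma k y) = ev (pcompose p (monom (Fract [:z ^ k:] 1) 1)) (zeta ^ j * x)"
    by (simp only: sigma_ev)
  also have "\<dots> = ev p (zeta ^ k * (zeta ^ j * x))"
    by (simp only: ev_pcompose_monom flip: emb_def) (simp add: emb_const_power zeta_def)
  finally show ?thesis using \<open>y = ev p x\<close> by (simp add: sigma_ev power_add mult_ac)
qed (simp add: sigma_outside)

lemma sigma_eq_self: "l dvd k \<Longrightarrow> sigma k y = y"
proof (cases "y \<in> K")
  case True
  assume "l dvd k"
  hence "zeta ^ k = 1" by (simp add: zeta_power_eq_1)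
  moreover obtain p where "y = ev p x" using True by (auto simp: K_def)
  ultimately show ?thesis by (simp add: sigma_ev)
qed (simp add: sigma_outside)

lemma sigma_funpow: "sigma 1 ^^ k = sigma k"
proof (induction k)
  case 0
  show ?case by (rule ext) (simp add: sigma_eq_self)
next
  case (Suc k)
  thus ?case by (auto simp: sigma_sigma)
qed

lemma sigma_in_gal: "sigma k \<in> gal K"
proof -
  \<comment> \<open>The natural number \<open>l * k - k\<close> stands for \<open>- k\<close>: added
    to \<open>k\<close> it gives a multiple of \<open>l\<close>.\<close>
  have inv: "sigma (l * k - k) (sigma k y) = y" "sigma k (sigma (l * k - k) y) = y" for y
    using l_gt_1 by (simp_all add: sigma_sigma sigma_eq_self)
  have "bij_betw (sigma k) K K"
    by (rule bij_betw_byWitness[where f' = "sigma (l * k - k)"]) (auto simp: inv sigma_in_K)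
  thus ?thesis unfolding gal_def
    by (auto simp: sigma_add sigma_mult sigma_base_field sigma_outside)
qed

text \<open>An automorphism sends \<open>x\<close> to another root of \<open>X ^ l - D\<close>,
  hence to some \<open>zeta ^ k * x\<close>, and is determined on \<open>K\<close> by this
  image.\<close>

lemma gal_subset:
  assumes "\<tau> \<in> gal K" obtains k where "k < l" "\<tau> = sigma k"
proof -
  have add: "\<tau> (a + b) = \<tau> a + \<tau> b" and mult: "\<tau> (a * b) = \<tau> a * \<tau> b" if "a \<in> K" "b \<in> K" for a b
    using assms that by (auto simp: gal_def)
  have base: "\<tau> a = a" if "a \<in> base_field" for a using assms that by (auto simp: gal_def)
  have out: "\<tau> a = a" if "a \<notin> K" for a using assms that by (auto simp: gal_def)
  have "\<tau> (x ^ n) = \<tau> x ^ n" for n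
    by (induction n) (simp_all add: base mult x_in_K K_power)
  hence "\<tau> x ^ l = emb D" by (metis base emb_in_base_field x_root)
  then obtain k where k: "k < l" "\<tau> x = zeta ^ k * x" by (rule root_is_conjugate)
  have ev_pCons: "ev (pCons a p) y = to_ac a + y * ev p y" for a p y
    by (simp add: ev_def to_ac_hom.map_poly_pCons_hom)
  have "\<tau> (ev p x) = ev p (\<tau> x)" for p
  proof (induction p)
    case 0
    show ?case by (simp add: base)
  next
    case (pCons a p)
    have a: "to_ac a \<in> base_field" by (simp add: base_field_def)
    hence "to_ac a \<in> K" using base_field_subset_K by blast
    thus ?case using pCons.IH a
      by (simp add: ev_pCons add mult base K_I x_in_K K_mult)
  qed
  hence "\<tau> y = sigma k y" for y
    by (cases "y \<in> K") (auto simp: K_def sigma_ev k(2) out sigma_outside)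
  hence "\<tau> = sigma k" by blast
  thus ?thesis using that k by blast
qed

lemma gal_eq: "gal K = sigma ` {..<l}"
  using gal_subset sigma_in_gal by blast

lemma card_gal: "card (gal K) = l"
proof -
  have "inj_on sigma {..<l}"
  proof (rule inj_onI)
    fix i j assume ij: "i \<in> {..<l}" "j \<in> {..<l}" "sigma i = sigma j"
    hence "zeta ^ i * x = zeta ^ j * x" by (metis sigma_x)
    thus "i = j" using ij zeta_power_inj x_nz by (auto dest: inj_onD)
  qed
  thus ?thesis by (simp add: gal_eq card_image)
qed

lemma cyclic_ext_K: "cyclic_ext K l"
  unfolding cyclic_ext_def
proof (intro conjI)
  show "\<exists>\<sigma>\<in>gal K. \<forall>\<tau>\<in>gal K. \<exists>k. \<tau> = \<sigma> ^^ k"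
  proof (rule bexI[of _ "sigma 1"], rule ballI)
    fix \<tau> assume "\<tau> \<in> gal K"
    then obtain k where "\<tau> = sigma k" by (auto simp: gal_eq)
    thus "\<exists>k. \<tau> = sigma 1 ^^ k" using sigma_funpow[of k] by metis
  qed (rule sigma_in_gal)
qed (use K_is_subfield base_field_subset_K basis_powers card_gal in auto)

lemma sigma_sum:
  assumes "finite S" "\<And>i. i \<in> S \<Longrightarrow> f i \<in> K"
  shows "sigma k (\<Sum>i\<in>S. f i) = (\<Sum>i\<in>S. sigma k (f i))"
  using assms by induction (simp_all add: sigma_base_field sigma_add K_sum)

lemma sigma_power: "y \<in> K \<Longrightarrow> sigma k (y ^ n) = sigma k y ^ n"
  by (induction n) (simp_all add: sigma_base_field sigma_mult K_power)

text \<open>The power basis diagonalises the Galois action: \<open>x ^ i\<close> is an eigenvector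
  of \<open>sigma k\<close> with eigenvalue \<open>zeta ^ (k * i)\<close>.\<close>

lemma sigma_coords:
  assumes "\<And>i. c i \<in> base_field"
  shows "sigma k (\<Sum>i<l. c i * x ^ i) = (\<Sum>i<l. c i * zeta ^ (k * i) * x ^ i)"
proof -
  have cK: "c i \<in> K" for i using assms base_field_subset_K by blast
  have "sigma k (c i * x ^ i) = c i * zeta ^ (k * i) * x ^ i" for i
    using cK assms by (simp add: sigma_mult sigma_power sigma_base_field K_power x_in_K sigma_x
        power_mult_distrib power_mult)
  thus ?thesis using cK by (simp add: sigma_sum K_mult K_power x_in_K)
qed

text \<open>Orthogonality of characters of the cyclic group of order \<open>l\<close>, by summing a
  geometric series of ratio \<open>zeta ^ m\<close>.\<close>

lemma sum_zeta: "(\<Sum>k<l. zeta ^ (m * k)) = (if l dvd m then of_nat l else 0)"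
proof (cases "l dvd m")
  case True
  hence "zeta ^ m = 1" by (simp add: zeta_power_eq_1)
  thus ?thesis using True by (simp add: power_mult)
next
  case False
  hence "zeta ^ m \<noteq> 1" by (simp add: zeta_power_eq_1)
  moreover have "(zeta ^ m) ^ l = 1" by (metis dvd_triv_right power_mult zeta_power_eq_1)
  ultimately show ?thesis using False geometric_sum[of "zeta ^ m" l] by (simp add: power_mult)
qed

section \<open>The ring of integers\<close>

lemma OK_iff: "y \<in> OK K \<longleftrightarrow> y \<in> K \<and> integral y"
  by (simp add: OK_def integral_def)

lemma integral_sigma:
  assumes "y \<in> K" "integral y" shows "integral (sigma k y)"
proof -
  obtain f :: "'a poly poly" where f: "lead_coeff f = 1" "poly (map_poly emb f) y = 0"
    using assms(2) by (auto simp: integral_def)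
  \<comment> \<open>Membership in \<open>K\<close> is carried through the induction because
    \<open>sigma k\<close> respects sums and products only there.\<close>
  have "poly (map_poly emb f) y \<in> K \<and>
    sigma k (poly (map_poly emb f) y) = poly (map_poly emb f) (sigma k y)" for f :: "'a poly poly"
  proof (induction f)
    case 0
    show ?case using base_field_subset_K by (auto simp: sigma_base_field)
  next
    case (pCons a f)
    have "emb a \<in> K" using base_field_subset_K emb_in_base_field by blast
    thus ?case using pCons.IH assms(1)
      by (simp add: emb_hom.map_poly_pCons_hom sigma_add sigma_mult K_add K_mult sigma_base_field)
  qed
  from this[of f] f have "poly (map_poly emb f) (sigma k y) = 0" by (simp add: sigma_base_field)
  thus ?thesis using f(1) unfolding integral_def by blast
qed

lemma of_nat_l_nz: "(of_nat l :: 'a) \<noteq> 0"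
  using of_nat_dvd_card_UNIV_minus_1[OF fin l_dvd] .

text \<open>Averaging the conjugates of \<open>y\<close> against a character isolates one term \<open>c j * x ^ j\<close>,
  whose \<open>l\<close>-th power lies in the base field; squarefreeness of \<open>D\<close> then bounds the denominator of \<open>c j\<close>.\<close>

lemma integral_coeff:
  assumes c: "\<And>i. c i \<in> base_field" and int: "integral (\<Sum>i<l. c i * x ^ i)" and j: "j < l"
  obtains w where "c j = emb w"
proof -
  define y where "y = (\<Sum>i<l. c i * x ^ i)"
  have cK: "c i \<in> K" for i using c base_field_subset_K by blast
  have yK: "y \<in> K" unfolding y_def by (intro K_sum K_mult cK K_power x_in_K)
  \<comment> \<open>The exponent \<open>l - j\<close> is \<open>- j\<close> modulo \<open>l\<close>,
    so the weights are the inverse character of \<open>x ^ j\<close>; the sum is \<open>l\<close>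
    times the projection to that eigenspace.\<close>
  let ?s = "\<Sum>k<l. zeta ^ ((l - j) * k) * sigma k y"
  have "integral ?s"
    by (intro integral_sum integral_mult integral_sigma yK int[folded y_def])
       (simp add: zeta_def flip: emb_const_power)
  moreover have "?s = of_nat l * (c j * x ^ j)"
  proof -
    have "?s = (\<Sum>k<l. \<Sum>i<l. zeta ^ ((l - j + i) * k) * (c i * x ^ i))"
      unfolding y_def sigma_coords[OF c] sum_distrib_left
      by (intro sum.cong refl) (simp add: power_add algebra_simps)
    also have "\<dots> = (\<Sum>i<l. (\<Sum>k<l. zeta ^ ((l - j + i) * k)) * (c i * x ^ i))"
      by (subst sum.swap) (simp add: sum_distrib_right)
    also have "\<dots> = (\<Sum>i<l. if i = j then of_nat l * (c j * x ^ j) else 0)"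
    proof (intro sum.cong refl)
      fix i assume i: "i \<in> {..<l}"
      have "l dvd l - j + i \<longleftrightarrow> i = j"
      proof
        assume "l dvd l - j + i"
        then obtain m where m: "l - j + i = l * m" by blast
        have "0 < l - j + i" "l - j + i < l * 2" using i j by auto
        hence "m = 1" unfolding m by auto
        thus "i = j" using m j by simp
      qed (use j in auto)
      thus "(\<Sum>k<l. zeta ^ ((l - j + i) * k)) * (c i * x ^ i) =
        (if i = j then of_nat l * (c j * x ^ j) else 0)" by (simp add: sum_zeta)
    qed
    finally show ?thesis using j by simp
  qed
  ultimately have "integral (emb [:inverse (of_nat l):] * (of_nat l * (c j * x ^ j)))"
    by (metis integral_emb integral_mult)
  moreover have "emb [:inverse (of_nat l):] * of_nat l = (1 :: 'a omega)"
  proof -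
    have "[:inverse (of_nat l):] * [:of_nat l:] = (1 :: 'a poly)"
      using of_nat_l_nz by (simp add: one_pCons)
    hence "emb ([:inverse (of_nat l):] * [:of_nat l:] :: 'a poly) = 1" by (simp only: emb_1)
    thus ?thesis unfolding emb_mult of_nat_eq_emb .
  qed
  ultimately have "integral (c j * x ^ j)" by (simp flip: mult.assoc)
  hence intl: "integral ((c j * x ^ j) ^ l)" by (rule integral_power)
  have "(x ^ j) ^ l = emb (D ^ j)"
    by (metis x_root power_mult mult.commute emb_hom.hom_power)
  hence eq: "(c j * x ^ j) ^ l = c j ^ l * emb (D ^ j)" by (simp add: power_mult_distrib)
  have "c j ^ n \<in> base_field" for n using c by (induction n) (auto intro: base_field_mult)
  hence "(c j * x ^ j) ^ l \<in> base_field" unfolding eq by (intro base_field_mult) auto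
  then obtain a where a: "(c j * x ^ j) ^ l = emb a" using integral_in_base_field[OF intl] by blast
  obtain q where q: "c j = to_ac q" using c[of j] by (auto simp: base_field_def)
  obtain u v where uv: "v \<noteq> 0" "q = Fract u v"
    and red: "\<And>P. prime_elem P \<Longrightarrow> P dvd v \<Longrightarrow> \<not> P dvd u"
    using reduced_fraction_exists[of q] by blast
  have cu: "c j * emb v = emb u" using q uv by (simp add: emb_def eq_fract flip: to_ac_mult)
  have "emb u ^ l * emb (D ^ j) = emb a * emb v ^ l"
    unfolding a[symmetric] eq cu[symmetric] by (simp add: power_mult_distrib mult_ac)
  hence "emb (u ^ l * D ^ j) = emb (a * v ^ l)" by (simp only: emb_mult emb_hom.hom_power)
  hence uv_eq: "u ^ l * D ^ j = a * v ^ l" by simp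
  have "\<not> P dvd v" if P: "prime_elem P" for P
  proof
    assume "P dvd v"
    hence "P ^ l dvd u ^ l * D ^ j" unfolding uv_eq by (simp add: dvd_power_same)
    hence "P dvd u" using prime_elem_dvd_of_power_dvd[OF P sqf j] by blast
    thus False using red[OF P \<open>P dvd v\<close>] by blast
  qed
  from reduced_fraction_unit[OF uv(1) this] obtain w where "Fract u v = Fract w 1" .
  thus ?thesis using q uv that[of w] by (simp add: emb_def)
qed

text \<open>One inclusion is \<open>integral_coeff\<close>, the other is integrality of
  \<open>x\<close>. Coordinates in this integral basis drive all later computations in the
  quotient.\<close>

lemma OK_eq: "OK K = {\<Sum>i<l. emb (c i) * x ^ i | c. True}"
proof (intro equalityI subsetI)
  fix y assume "y \<in> OK K"
  hence y: "y \<in> K" "integral y" by (auto simp: OK_iff)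
  obtain c where c: "\<And>i. c i \<in> base_field" "y = (\<Sum>i<l. c i * x ^ i)" using K_E[OF y(1)] by blast
  have "\<forall>j. \<exists>w. j < l \<longrightarrow> c j = emb w" using integral_coeff[OF c(1) y(2)[unfolded c(2)]] by metis
  then obtain w where "\<And>j. j < l \<Longrightarrow> c j = emb (w j)" by metis
  thus "y \<in> {\<Sum>i<l. emb (c i) * x ^ i | c. True}" using c(2) by auto
next
  fix y assume "y \<in> {\<Sum>i<l. emb (c i) * x ^ i | c. True}"
  then obtain c where y: "y = (\<Sum>i<l. emb (c i) * x ^ i)" by blast
  have "emb (c i) \<in> K" for i using base_field_subset_K emb_in_base_field by blast
  thus "y \<in> OK K" unfolding y OK_iff
    by (intro conjI K_sum integral_sum K_mult integral_mult K_power integral_power x_in_K integral_x integral_emb)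
qed

end

section \<open>Traces and discriminants\<close>

global_interpretation omega_vs: vector_space "\<lambda>(c :: 'a::field poly fract) (y :: 'a omega). to_ac c * y"
  by standard (simp_all add: algebra_simps)

lemma is_basis_coords:
  assumes "is_basis K n b" "y \<in> K"
  shows "i < n \<Longrightarrow> coords K n b y i \<in> base_field" "y = (\<Sum>i<n. coords K n b y i * b i)"
proof -
  let ?P = "\<lambda>c. (\<forall>i<n. c i \<in> base_field) \<and> (\<forall>i\<ge>n. c i = 0) \<and> y = (\<Sum>i<n. c i * b i)"
  have "\<exists>!c. ?P c" using assms by (auto simp: is_basis_def)
  hence "?P (coords K n b y)" unfolding coords_def by (rule theI')
  thus "i < n \<Longrightarrow> coords K n b y i \<in> base_field" "y = (\<Sum>i<n. coords K n b y i * b i)" by auto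
qed

lemma coords_eqI:
  assumes b: "is_basis K n b" and y: "y \<in> K"
    and c: "\<And>i. i < n \<Longrightarrow> c i \<in> base_field" "y = (\<Sum>i<n. c i * b i)" and j: "j < n"
  shows "coords K n b y j = c j"
proof -
  let ?P = "\<lambda>c. (\<forall>i<n. c i \<in> base_field) \<and> (\<forall>i\<ge>n. c i = 0) \<and> y = (\<Sum>i<n. c i * b i)"
  have ex: "\<exists>!c. ?P c" using b y by (auto simp: is_basis_def)
  then obtain c0 where c0: "\<And>c. ?P c \<Longrightarrow> c = c0" by (rule ex1E) blast
  have 1: "?P (coords K n b y)" unfolding coords_def by (rule theI'[OF ex])
  have 2: "?P (\<lambda>i. if i < n then c i else 0)" using c by auto
  have "coords K n b y = (\<lambda>i. if i < n then c i else 0)"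
    by (rule trans[OF c0[OF 1] c0[OF 2, symmetric]])
  thus ?thesis using j by simp
qed

locale field_extension =
  fixes K :: "'a::field omega set"
  assumes subfield: "is_subfield K" and base_sub: "base_field \<subseteq> K"
begin

lemma add_closed: "a \<in> K \<Longrightarrow> b \<in> K \<Longrightarrow> a + b \<in> K"
  and mult_closed: "a \<in> K \<Longrightarrow> b \<in> K \<Longrightarrow> a * b \<in> K"
  using subfield by (auto simp: is_subfield_def)

lemma sum_closed: "(\<And>i. i \<in> S \<Longrightarrow> f i \<in> K) \<Longrightarrow> (\<Sum>i\<in>S. f i) \<in> K"
  using base_sub by (induction S rule: infinite_finite_induct) (auto intro: add_closed)

lemma scale_closed: "a \<in> base_field \<Longrightarrow> b \<in> K \<Longrightarrow> a * b \<in> K"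
  using base_sub mult_closed by blast

lemma coords_sum:
  assumes b: "is_basis K n b" and a: "\<And>k. k < m \<Longrightarrow> a k \<in> base_field" and y: "\<And>k. k < m \<Longrightarrow> y k \<in> K"
    and i: "i < n"
  shows "coords K n b (\<Sum>k<m. a k * y k) i = (\<Sum>k<m. a k * coords K n b (y k) i)"
proof (rule coords_eqI[OF b _ _ _ i])
  show "(\<Sum>k<m. a k * y k) \<in> K" using a y by (auto intro: sum_closed scale_closed)
  show "(\<Sum>k<m. a k * coords K n b (y k) j) \<in> base_field" if "j < n" for j
    using a y that is_basis_coords(1)[OF b] by (auto intro!: base_field_sum base_field_mult)
  have "(\<Sum>k<m. a k * y k) = (\<Sum>k<m. a k * (\<Sum>i<n. coords K n b (y k) i * b i))"
    using is_basis_coords(2)[OF b y] by (intro sum.cong) auto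
  also have "\<dots> = (\<Sum>k<m. \<Sum>i<n. a k * coords K n b (y k) i * b i)"
    by (simp add: sum_distrib_left mult.assoc)
  also have "\<dots> = (\<Sum>i<n. (\<Sum>k<m. a k * coords K n b (y k) i) * b i)"
    by (subst sum.swap) (simp add: sum_distrib_right)
  finally show "(\<Sum>k<m. a k * y k) = (\<Sum>i<n. (\<Sum>k<m. a k * coords K n b (y k) i) * b i)" .
qed

lemma coords_basis:
  assumes b: "is_basis K n b" and "k < n" "i < n"
  shows "coords K n b (b k) i = (if i = k then 1 else 0)"
proof (rule coords_eqI[OF b _ _ _ assms(3)])
  show "b k \<in> K" using b assms(2) by (auto simp: is_basis_def)
  show "b k = (\<Sum>i<n. (if i = k then 1 else 0) * b i)" using assms(2) by (simp add: if_distrib[of "\<lambda>t. t * _"] cong: if_cong)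
qed auto

text \<open>The definition of \<open>trace\<close> picks an unspecified basis, so a computation in
  the power basis needs invariance under change of basis: conjugating by a transition matrix
  preserves the trace.\<close>

lemma trace_change_of_basis:
  assumes b: "is_basis K n b" and b': "is_basis K n b'" and y: "y \<in> K"
  shows "(\<Sum>j<n. coords K n b' (y * b' j) j) = (\<Sum>i<n. coords K n b (y * b i) i)"
proof -
  let ?C = "coords K n b" and ?C' = "coords K n b'"
  have bK: "b i \<in> K" and b'K: "b' i \<in> K" if "i < n" for i using b b' that by (auto simp: is_basis_def)
  note C = is_basis_coords[OF b] and C' = is_basis_coords[OF b']
  have "?C' (y * b' j) j = (\<Sum>i<n. \<Sum>k<n. ?C (b' j) i * (?C (y * b i) k * ?C' (b k) j))" if j: "j < n" for j
  proof -
    have "y * b' j = y * (\<Sum>i<n. ?C (b' j) i * b i)" using C(2)[OF b'K[OF j]] by simp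
    also have "\<dots> = (\<Sum>i<n. ?C (b' j) i * (y * b i))" by (simp add: sum_distrib_left mult.left_commute)
    finally have "?C' (y * b' j) j = (\<Sum>i<n. ?C (b' j) i * ?C' (y * b i) j)"
      using coords_sum[OF b', of n "?C (b' j)" "\<lambda>i. y * b i" j] C(1)[OF b'K[OF j]] j y
      by (simp add: mult_closed bK)
    moreover have "?C' (y * b i) j = (\<Sum>k<n. ?C (y * b i) k * ?C' (b k) j)" if i: "i < n" for i
    proof -
      have yb: "y * b i \<in> K" using y bK[OF i] by (rule mult_closed)
      have "?C' (\<Sum>k<n. ?C (y * b i) k * b k) j = (\<Sum>k<n. ?C (y * b i) k * ?C' (b k) j)"
        by (rule coords_sum[OF b']) (use C(1)[OF yb] bK j in auto)
      thus ?thesis using C(2)[OF yb] by simp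
    qed
    ultimately show ?thesis by (simp add: sum_distrib_left)
  qed
  hence "(\<Sum>j<n. ?C' (y * b' j) j) =
    (\<Sum>j<n. \<Sum>i<n. \<Sum>k<n. ?C (b' j) i * (?C (y * b i) k * ?C' (b k) j))" by simp
  also have "\<dots> = (\<Sum>i<n. \<Sum>j<n. \<Sum>k<n. ?C (b' j) i * (?C (y * b i) k * ?C' (b k) j))"
    by (rule sum.swap)
  also have "\<dots> = (\<Sum>i<n. \<Sum>k<n. \<Sum>j<n. ?C (b' j) i * (?C (y * b i) k * ?C' (b k) j))"
    by (intro sum.cong refl sum.swap)
  \<comment> \<open>The sum over \<open>j\<close> is an entry of the product of the two mutually
    inverse transition matrices.\<close>
  also have "\<dots> = (\<Sum>i<n. \<Sum>k<n. ?C (y * b i) k * (\<Sum>j<n. ?C' (b k) j * ?C (b' j) i))"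
    by (simp add: sum_distrib_left mult_ac)
  also have "\<dots> = (\<Sum>i<n. \<Sum>k<n. ?C (y * b i) k * (if i = k then 1 else 0))"
  proof (intro sum.cong refl arg_cong2[where f = "(*)"])
    fix i k assume ik: "i \<in> {..<n}" "k \<in> {..<n}"
    have "(\<Sum>j<n. ?C' (b k) j * ?C (b' j) i) = ?C (\<Sum>j<n. ?C' (b k) j * b' j) i"
      by (rule coords_sum[OF b, symmetric]) (use C'(1)[OF bK] b'K ik in auto)
    also have "(\<Sum>j<n. ?C' (b k) j * b' j) = b k" using C'(2)[OF bK, of k] ik by simp
    finally show "(\<Sum>j<n. ?C' (b k) j * ?C (b' j) i) = (if i = k then 1 else 0)"
      using coords_basis[OF b] ik by simp
  qed
  finally show ?thesis by (simp add: if_distrib[of "(*) _"] cong: if_cong)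
qed

text \<open>\<open>ext_degree\<close> picks some length of a basis; it is determined once every such
  length is identified with the vector space dimension.\<close>

lemma basis_dim:
  assumes b: "is_basis K n b"
  shows "omega_vs.dim K = n"
proof -
  have bK: "b i \<in> K" if "i < n" for i using b that by (auto simp: is_basis_def)
  have inj: "inj_on b {..<n}"
  proof (rule inj_onI)
    fix i j assume ij: "i \<in> {..<n}" "j \<in> {..<n}" "b i = b j"
    hence "coords K n b (b i) i = coords K n b (b j) i" by simp
    thus "i = j" using ij coords_basis[OF b, of i i] coords_basis[OF b, of j i] by (auto split: if_splits)
  qed
  have ind: "omega_vs.independent (b ` {..<n})"
  proof
    assume "omega_vs.dependent (b ` {..<n})"
    then obtain u i where u: "i < n" "u (b i) \<noteq> 0" "(\<Sum>v\<in>b ` {..<n}. to_ac (u v) * v) = 0"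
      by (auto simp: omega_vs.dependent_finite)
    hence "0 = (\<Sum>i<n. to_ac (u (b i)) * b i)" by (simp add: sum.reindex[OF inj])
    hence "coords K n b 0 i = to_ac (u (b i))" using u(1) base_sub
      by (intro coords_eqI[OF b]) (auto simp: base_field_def)
    moreover have "0 \<in> K" using base_sub base_field_0 by blast
    hence "coords K n b 0 i = 0" using coords_eqI[OF b, of 0 "\<lambda>_. 0" i] u(1) by simp
    ultimately show False using u(2) by simp
  qed
  have "K \<subseteq> omega_vs.span (b ` {..<n})"
  proof
    fix y assume y: "y \<in> K"
    have "(\<Sum>i<n. coords K n b y i * b i) \<in> omega_vs.span (b ` {..<n})"
    proof (rule omega_vs.span_sum)
      fix i assume i: "i \<in> {..<n}"
      then obtain q where "coords K n b y i = to_ac q"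
        using is_basis_coords(1)[OF b y, of i] by (auto simp: base_field_def)
      thus "coords K n b y i * b i \<in> omega_vs.span (b ` {..<n})"
        using i by (auto intro: omega_vs.span_scale omega_vs.span_base)
    qed
    thus "y \<in> omega_vs.span (b ` {..<n})" by (subst is_basis_coords(2)[OF b y])
  qed
  moreover have "b ` {..<n} \<subseteq> K" using bK by auto
  ultimately have "omega_vs.dim K = card (b ` {..<n})"
    using ind omega_vs.dim_unique by metis
  thus ?thesis by (simp add: card_image[OF inj])
qed

lemma ext_degree_eq:
  assumes "is_basis K n b" shows "ext_degree K = n"
proof -
  have "\<exists>b. is_basis K (ext_degree K) b"
    unfolding ext_degree_def by (rule someI[of _ n]) (use assms in blast)
  thus ?thesis using basis_dim assms by metis
qed

lemma trace_eq:
  assumes b: "is_basis K n b" and y: "y \<in> K"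
  shows "trace K y = (\<Sum>i<n. coords K n b (y * b i) i)"
proof -
  have "is_basis K n (SOME b. is_basis K n b)" using someI[of "is_basis K n" b] b by simp
  from trace_change_of_basis[OF b this y] show ?thesis
    by (simp add: trace_def ext_degree_eq[OF b] Let_def)
qed

end

context kummer
begin

sublocale field_extension K
  by standard (rule K_is_subfield, rule base_field_subset_K)

lemma ext_degree_K: "ext_degree K = l" by (rule ext_degree_eq[OF basis_powers])

lemma power_x: "x ^ n = emb (D ^ (n div l)) * x ^ (n mod l)"
proof -
  have "x ^ n = x ^ (l * (n div l) + n mod l)" by simp
  also have "\<dots> = emb (D ^ (n div l)) * x ^ (n mod l)"
    by (simp only: power_add power_mult x_root emb_hom.hom_power)
  finally show ?thesis .
qed

text \<open>Multiplication by \<open>x ^ m\<close> shifts the power basis cyclically by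
  \<open>m\<close> modulo \<open>l\<close>, up to powers of \<open>D\<close>. Its matrix has nonzero
  diagonal entries only if \<open>l\<close> divides \<open>m\<close>, and then all \<open>l\<close>
  of them equal \<open>D ^ (m div l)\<close>.\<close>

lemma trace_power: "trace K (x ^ m) = (if l dvd m then emb (of_nat l * D ^ (m div l)) else 0)"
proof -
  have l0: "l > 0" using l_gt_1 by simp
  have co: "coords K l (\<lambda>i. x ^ i) (x ^ n) i = (if i = n mod l then emb (D ^ (n div l)) else 0)"
    if "i < l" for n i
  proof (rule coords_eqI[OF basis_powers _ _ _ that])
    have A: "(\<Sum>i<l. (if i = n mod l then emb (D ^ (n div l)) else 0) * x ^ i) = emb (D ^ (n div l)) * x ^ (n mod l)"
      using l0 by (simp add: if_distrib[of "\<lambda>t. t * _"] cong: if_cong)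
    show "x ^ n = (\<Sum>i<l. (if i = n mod l then emb (D ^ (n div l)) else 0) * x ^ i)"
      using trans[OF power_x[of n] A[symmetric]] .
  qed (auto simp: K_power x_in_K)
  have "trace K (x ^ m) = (\<Sum>i<l. coords K l (\<lambda>i. x ^ i) (x ^ (m + i)) i)"
    by (simp add: trace_eq[OF basis_powers] K_power x_in_K power_add)
  also have "\<dots> = (\<Sum>i<l. if l dvd m then emb (D ^ (m div l)) else 0)"
  proof (intro sum.cong refl)
    fix i assume i: "i \<in> {..<l}"
    have "i = (m + i) mod l \<longleftrightarrow> l dvd m"
    proof
      assume "i = (m + i) mod l"
      hence "(m + i) mod l = (0 + i) mod l" using i by simp
      thus "l dvd m" by (metis add_diff_cancel_right' add.left_neutral le_add2 mod_eq_dvd_iff_nat)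
    next
      assume "l dvd m"
      then obtain k where "m = l * k" by blast
      thus "i = (m + i) mod l" using i by simp
    qed
    moreover have "(m + i) div l = m div l" if "l dvd m"
      using that i l0 by (auto elim!: dvdE)
    ultimately show "coords K l (\<lambda>i. x ^ i) (x ^ (m + i)) i = (if l dvd m then emb (D ^ (m div l)) else 0)"
      using co[of i "m + i"] i by auto
  qed
  finally show ?thesis by (simp add: emb_mult emb_hom.hom_of_nat)
qed

text \<open>The only permutation contributing to the discriminant of the power basis is \<open>i \<mapsto> - i\<close> modulo \<open>l\<close>.\<close>

lemma disc_coprime_K:
  assumes cop: "\<And>P. irreducible P \<Longrightarrow> P dvd g \<Longrightarrow> \<not> P dvd D"
  shows "disc_coprime K g"
  unfolding disc_coprime_def
proof (intro allI impI notI)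
  fix P assume P: "irreducible P \<and> P dvd g" and all: "\<forall>d\<in>disc_gens K. P dvd d"
  \<comment> \<open>The reduction modulo \<open>l\<close> matters only at \<open>i = 0\<close>,
    which has to be fixed; outside the index range \<open>permutes\<close> requires the
    identity.\<close>
  define p0 where "p0 i = (if i < l then (l - i) mod l else i)" for i :: nat
  have l0: "l > 0" using l_gt_1 by simp
  have p0p0: "p0 (p0 i) = i" for i using l0 by (cases "i = 0") (auto simp: p0_def)
  have p0: "p0 permutes {..<l}"
    unfolding permutes_def
  proof (intro conjI allI impI)
    fix y show "\<exists>!i. p0 i = y" using p0p0 by metis
  qed (auto simp: p0_def)
  have dvd_p0: "l dvd i + p0 i" if "i < l" for i
    using that by (cases "i = 0") (auto simp: p0_def)
  define d where "d = of_int (sign p0) * (\<Prod>i<l. of_nat l * D ^ ((i + p0 i) div l))"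
  have "emb d = of_int (sign p0) * (\<Prod>i<l. trace K (x ^ i * x ^ p0 i))"
    using dvd_p0 by (simp add: d_def emb_mult emb_hom.hom_of_int emb_hom.hom_prod trace_power flip: power_add)
  also have "\<dots> = (\<Sum>p\<in>{p0}. of_int (sign p) * (\<Prod>i<l. trace K (x ^ i * x ^ p i)))" by simp
  also have "\<dots> = (\<Sum>p | p permutes {..<l}. of_int (sign p) * (\<Prod>i<l. trace K (x ^ i * x ^ p i)))"
  proof (rule sum.mono_neutral_left)
    show "finite {p. p permutes {..<l}}" by (rule finite_permutations) simp
    show "{p0} \<subseteq> {p. p permutes {..<l}}" using p0 by simp
    show "\<forall>p\<in>{p. p permutes {..<l}} - {p0}. of_int (sign p) * (\<Prod>i<l. trace K (x ^ i * x ^ p i)) = 0"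
    proof
      fix p assume "p \<in> {p. p permutes {..<l}} - {p0}"
      hence p: "p permutes {..<l}" "p \<noteq> p0" by auto
      then obtain i where i: "p i \<noteq> p0 i" by blast
      hence il: "i < l" using p(1) p0 by (metis lessThan_iff permutes_not_in)
      have pil: "p i < l" "p0 i < l"
        using permutes_in_image[OF p(1), of i] permutes_in_image[OF p0, of i] il by simp_all
      have "\<not> l dvd i + p i"
      proof
        assume "l dvd i + p i"
        then obtain a where a: "i + p i = l * a" by blast
        obtain b where b: "i + p0 i = l * b" using dvd_p0[OF il] by blast
        \<comment> \<open>The multiples \<open>l * a\<close> and \<open>l * b\<close> differ by less
          than \<open>l\<close>, since \<open>p i\<close> and \<open>p0 i\<close> both lie below
          \<open>l\<close>.\<close>
        have "\<not> a < b" "\<not> b < a"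
          using mult_le_mono2[of "Suc a" b l] mult_le_mono2[of "Suc b" a l] a b pil by auto
        hence "a = b" by simp
        thus False using a b i by simp
      qed
      hence "trace K (x ^ i * x ^ p i) = 0" by (simp add: trace_power flip: power_add)
      hence "(\<Prod>i<l. trace K (x ^ i * x ^ p i)) = 0" using il by (intro prod_zero) auto
      thus "of_int (sign p) * (\<Prod>i<l. trace K (x ^ i * x ^ p i)) = 0" by simp
    qed
  qed
  finally have "d \<in> disc_gens K"
    unfolding disc_gens_def ext_degree_K
    by (auto simp: OK_iff K_power x_in_K integral_power integral_x intro!: exI[of _ "\<lambda>i. x ^ i"])
  hence Pd: "P dvd d" using all by blast
  have pr: "prime_elem P" using P field_poly_irreducible_imp_prime by blast
  have nD: "\<not> P dvd D ^ n" for n using cop P pr prime_elem_dvd_power by blast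
  have nu: "\<not> P dvd 1" using pr unfolding prime_elem_def by blast
  \<comment> \<open>In \<open>d\<close> the sign and the factors \<open>l\<close> are units, so
    \<open>P\<close> could only divide a power of \<open>D\<close>.\<close>
  have "(of_nat l :: 'a poly) dvd 1"
    using of_nat_l_nz by (simp add: of_nat_poly is_unit_const_poly_iff dvd_field_iff)
  hence nl: "\<not> P dvd of_nat l" using nu dvd_trans by blast
  have ns: "\<not> P dvd of_int (sign p0)"
    using nu by (cases "evenperm p0") (auto simp: sign_def)
  have "\<not> P dvd (\<Prod>i\<in>S. of_nat l * D ^ ((i + p0 i) div l))" if "finite S" for S
    using that by induction (simp_all only: prod.empty prod.insert prime_elem_dvd_mult_iff[OF pr] nl nD nu not_False_eq_True simp_thms)
  thus False using Pd ns unfolding d_def by (simp add: prime_elem_dvd_mult_iff[OF pr])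
qed

end

section \<open>The Carmichael property\<close>

text \<open>Iterating \<open>fermat_poly\<close> gives the exponent
  \<open>q ^ (degree P * k)\<close> for every \<open>k\<close>, in particular \<open>q ^ e\<close>;
  \<open>squarefree_dvd\<close> then combines the irreducible factors.\<close>

lemma fermat_poly_squarefree:
  fixes g c :: "'a::field poly"
  assumes fin: "finite (UNIV :: 'a set)" and g: "squarefree g" "g \<noteq> 0"
    and deg: "\<And>P. irreducible P \<Longrightarrow> P dvd g \<Longrightarrow> degree P dvd e"
  shows "g dvd c ^ (card (UNIV :: 'a set) ^ e) - c"
proof (rule squarefree_dvd[OF g])
  let ?q = "card (UNIV :: 'a set)"
  fix P :: "'a poly" assume P: "irreducible P" "P dvd g"
  have "P dvd c ^ (?q ^ (degree P * k)) - c" for k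
  proof (induction k)
    case (Suc k)
    have "c ^ (?q ^ (degree P * Suc k)) = (c ^ (?q ^ (degree P * k))) ^ (?q ^ degree P)"
      by (simp add: power_add mult.commute flip: power_mult)
    with dvd_add[OF fermat_poly[OF fin P(1), of "c ^ (?q ^ (degree P * k))"] Suc.IH]
    show ?case by simp
  qed simp
  thus "P dvd c ^ (?q ^ e) - c" using deg[OF P] by (auto elim: dvdE)
qed

text \<open>Supplies the homomorphism that \<open>freshman_power\<close> requires in the algebraic
  closure.\<close>

lemma comm_ring_hom_emb_const: "comm_ring_hom (\<lambda>a :: 'a::field. emb [:a:])"
proof
  fix a b :: 'a
  show "emb [:a + b:] = emb [:a:] + emb [:b:]" by (simp flip: emb_add)
  show "emb [:a * b:] = emb [:a:] * emb [:b:]" by (simp flip: emb_mult)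
qed (simp_all flip: one_pCons)

context kummer
begin

lemma OK_closed:
  shows OK_0: "0 \<in> OK K" and OK_1: "1 \<in> OK K" and OK_emb: "emb p \<in> OK K" and OK_x: "x \<in> OK K"
    and OK_add: "a \<in> OK K \<Longrightarrow> b \<in> OK K \<Longrightarrow> a + b \<in> OK K"
    and OK_mult: "a \<in> OK K \<Longrightarrow> b \<in> OK K \<Longrightarrow> a * b \<in> OK K"
    and OK_uminus: "a \<in> OK K \<Longrightarrow> - a \<in> OK K"
  using base_field_subset_K
  by (auto simp: OK_iff x_in_K integral_x K_add K_mult K_minus integral_add integral_mult integral_uminus)

lemma OK_sum: "(\<And>i. i \<in> S \<Longrightarrow> f i \<in> OK K) \<Longrightarrow> (\<Sum>i\<in>S. f i) \<in> OK K"
  by (induction S rule: infinite_finite_induct) (auto intro: OK_0 OK_add)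

lemma OK_power: "a \<in> OK K \<Longrightarrow> a ^ n \<in> OK K"
  by (induction n) (auto intro: OK_1 OK_mult)

lemma OK_diff: "a \<in> OK K \<Longrightarrow> b \<in> OK K \<Longrightarrow> a - b \<in> OK K"
  using OK_add[of a "- b"] OK_uminus by simp

lemma cring_OK_ring: "cring (OK_ring K)"
proof (rule cringI)
  show "abelian_group (OK_ring K)"
    by (rule abelian_groupI)
       (auto simp: OK_ring_def OK_0 OK_add add_ac intro!: bexI[of _ "- y" for y] OK_uminus)
  show "Group.comm_monoid (OK_ring K)"
    by (rule comm_monoidI) (auto simp: OK_ring_def OK_1 OK_mult mult_ac)
qed (simp add: OK_ring_def distrib_right)

lemma OK_ring_simps [simp]:
  "carrier (OK_ring K) = OK K" "a \<otimes>\<^bsub>OK_ring K\<^esub> b = a * b" "a \<oplus>\<^bsub>OK_ring K\<^esub> b = a + b"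
  "\<one>\<^bsub>OK_ring K\<^esub> = 1" "\<zero>\<^bsub>OK_ring K\<^esub> = 0"
  by (simp_all add: OK_ring_def)

lemma OK_ring_minus: "a \<in> OK K \<Longrightarrow> b \<in> OK K \<Longrightarrow> a \<ominus>\<^bsub>OK_ring K\<^esub> b = a - b"
proof -
  assume ab: "a \<in> OK K" "b \<in> OK K"
  interpret R: cring "OK_ring K" by (rule cring_OK_ring)
  have "\<ominus>\<^bsub>OK_ring K\<^esub> b = - b"
    by (rule R.minus_equality) (use ab OK_uminus in auto)
  thus ?thesis by (simp add: a_minus_def)
qed

lemma OK_ring_pow: "a [^]\<^bsub>OK_ring K\<^esub> (n :: nat) = a ^ n"
  by (induction n) (simp_all add: mult.commute)

definition gen_ideal :: "'a poly \<Rightarrow> 'a omega set" where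
  "gen_ideal g = PIdl\<^bsub>OK_ring K\<^esub> (emb g)"

lemma ideal_gen_ideal: "ideal (gen_ideal g) (OK_ring K)"
  unfolding gen_ideal_def by (rule cring.cgenideal_ideal[OF cring_OK_ring]) (simp add: OK_emb)

lemma gen_ideal_iff: "y \<in> gen_ideal g \<longleftrightarrow> (\<exists>w\<in>OK K. y = w * emb g)"
  by (auto simp: gen_ideal_def cgenideal_def)

text \<open>Multiplication by \<open>g\<close> acts on each coordinate separately, and coordinates
  are unique, so membership becomes divisibility of polynomials.\<close>

lemma sum_in_gen_ideal_iff:
  "(\<Sum>i<l. emb (c i) * x ^ i) \<in> gen_ideal g \<longleftrightarrow> (\<forall>i<l. g dvd c i)"
proof
  assume "(\<Sum>i<l. emb (c i) * x ^ i) \<in> gen_ideal g"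
  then obtain w where w: "w \<in> OK K" "(\<Sum>i<l. emb (c i) * x ^ i) = w * emb g"
    by (auto simp: gen_ideal_iff)
  then obtain d where d: "w = (\<Sum>i<l. emb (d i) * x ^ i)" by (auto simp: OK_eq)
  have "emb (d i) * x ^ i * emb g = emb (d i * g) * x ^ i" for i by (simp only: emb_mult mult_ac)
  hence "w * emb g = (\<Sum>i<l. emb (d i * g) * x ^ i)" by (simp only: d sum_distrib_right)
  hence "(\<Sum>i<l. emb (c i) * x ^ i) = (\<Sum>i<l. emb (d i * g) * x ^ i)"
    by (rule trans[OF w(2)])
  hence "emb (c i) = emb (d i * g)" if "i < l" for i
    using powers_coeff_unique[of "\<lambda>i. emb (c i)" "\<lambda>i. emb (d i * g)" i] that by simp
  thus "\<forall>i<l. g dvd c i" by (simp only: emb_hom.eq_iff) auto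
next
  assume "\<forall>i<l. g dvd c i"
  hence "\<forall>i. \<exists>d. i < l \<longrightarrow> c i = d * g" by (metis dvdE mult.commute)
  then obtain d where d: "\<And>i. i < l \<Longrightarrow> c i = d i * g" by metis
  have "(\<Sum>i<l. emb (c i) * x ^ i) = (\<Sum>i<l. emb (d i) * x ^ i) * emb g"
    unfolding sum_distrib_right
  proof (intro sum.cong refl)
    fix i assume "i \<in> {..<l}"
    hence "c i = d i * g" using d by blast
    thus "emb (c i) * x ^ i = emb (d i) * x ^ i * emb g" by (simp only: emb_mult mult_ac)
  qed
  thus "(\<Sum>i<l. emb (c i) * x ^ i) \<in> gen_ideal g" by (auto simp: gen_ideal_iff OK_eq)
qed

definition residue_class :: "'a poly \<Rightarrow> 'a omega \<Rightarrow> 'a omega set" where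
  "residue_class g a = gen_ideal g +>\<^bsub>OK_ring K\<^esub> a"

lemma residue_class_eq_iff:
  assumes "a \<in> OK K" "b \<in> OK K"
  shows "residue_class g a = residue_class g b \<longleftrightarrow> a - b \<in> gen_ideal g"
  using ring.quotient_eq_iff_same_a_r_cos[OF cring.axioms(1)[OF cring_OK_ring] ideal_gen_ideal, of a b] assms
  by (simp add: OK_ring_minus residue_class_def)

lemma carrier_quotient: "carrier (OK_ring K Quot gen_ideal g) = residue_class g ` OK K"
  by (auto simp: FactRing_def A_RCOSETS_def' residue_class_def)

lemma residue_class_hom: "ring_hom_ring (OK_ring K) (OK_ring K Quot gen_ideal g) (residue_class g)"
  using ideal.rcos_ring_hom_ring[OF ideal_gen_ideal, of g] by (simp add: residue_class_def[abs_def])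

text \<open>Reducing each coordinate modulo \<open>g\<close> picks exactly one representative per
  class, so classes correspond to \<open>l\<close>-tuples of remainders. The extensional function
  space ensures that a tuple is determined by its first \<open>l\<close> entries.\<close>

lemma card_quotient:
  assumes "g \<noteq> 0"
  shows "finite (carrier (OK_ring K Quot gen_ideal g))"
    "card (carrier (OK_ring K Quot gen_ideal g)) = card (UNIV :: 'a set) ^ (degree g * l)"
proof -
  let ?B = "{p :: 'a poly. p = 0 \<or> degree p < degree g}"
  let ?S = "{..<l} \<rightarrow>\<^sub>E ?B"
  define s where "s c = (\<Sum>i<l. emb (c i) * x ^ i)" for c
  have sOK: "s c \<in> OK K" for c by (auto simp: s_def OK_eq)
  have sdiff: "s c - s d = s (\<lambda>i. c i - d i)" for c d
    by (simp add: s_def left_diff_distrib emb_hom.hom_minus flip: sum_subtractf)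
  have eq_iff: "residue_class g (s c) = residue_class g (s d) \<longleftrightarrow> (\<forall>i<l. g dvd c i - d i)" for c d
    using sum_in_gen_ideal_iff[of "\<lambda>i. c i - d i" g]
    by (simp only: residue_class_eq_iff[OF sOK sOK] sdiff) (simp add: s_def)
  have B: "finite ?B" "card ?B = card (UNIV :: 'a set) ^ degree g"
    using card_poly_degree_less[OF fin, of "degree g"] by auto
  have inj: "inj_on (\<lambda>c. residue_class g (s c)) ?S"
  proof (rule inj_onI)
    fix c d assume cd: "c \<in> ?S" "d \<in> ?S" "residue_class g (s c) = residue_class g (s d)"
    show "c = d"
    proof (rule PiE_ext[OF cd(1,2)])
      fix i assume i: "i \<in> {..<l}"
      hence "c i \<in> ?B" "d i \<in> ?B" using cd by auto
      hence "c i - d i = 0 \<or> degree (c i - d i) < degree g"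
        using degree_diff_less[of "c i" "degree g" "d i"] by auto
      moreover have "g dvd c i - d i" using cd(3) i by (simp add: eq_iff)
      ultimately show "c i = d i" using dvd_imp_degree_le[of g "c i - d i"] by fastforce
    qed
  qed
  have "carrier (OK_ring K Quot gen_ideal g) = (\<lambda>c. residue_class g (s c)) ` ?S"
  proof (intro equalityI subsetI)
    fix C assume "C \<in> carrier (OK_ring K Quot gen_ideal g)"
    then obtain c where C: "C = residue_class g (s c)"
      by (auto simp: carrier_quotient OK_eq s_def)
    let ?d = "restrict (\<lambda>i. c i mod g) {..<l}"
    have "?d \<in> ?S" using degree_mod_less[OF assms] by auto
    moreover have "g dvd c i - c i mod g" for i by (simp add: minus_mod_eq_mult_div)
    hence "C = residue_class g (s ?d)" unfolding C eq_iff by simp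
    ultimately show "C \<in> (\<lambda>c. residue_class g (s c)) ` ?S" by blast
  qed (auto simp: carrier_quotient sOK)
  thus "finite (carrier (OK_ring K Quot gen_ideal g))"
    "card (carrier (OK_ring K Quot gen_ideal g)) = card (UNIV :: 'a set) ^ (degree g * l)"
    using B by (simp_all add: finite_PiE card_image[OF inj] card_PiE power_mult)
qed

lemma card_power_cong_1: obtains m where "card (UNIV :: 'a set) ^ e = l * m + 1"
proof -
  have "\<exists>m. card (UNIV :: 'a set) ^ e = l * m + 1"
  proof (induction e)
    case (Suc e)
    then obtain m where m: "card (UNIV :: 'a set) ^ e = l * m + 1" by blast
    obtain k where "card (UNIV :: 'a set) - 1 = l * k" using l_dvd by blast
    moreover have "card (UNIV :: 'a set) > 0" using fin by (simp add: card_gt_0_iff)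
    ultimately have "card (UNIV :: 'a set) = l * k + 1" by simp
    hence "card (UNIV :: 'a set) ^ Suc e = l * (k * (l * m + 1) + m) + 1"
      using m by (simp add: algebra_simps)
    thus ?case by blast
  qed (auto intro: exI[of _ 0])
  thus ?thesis using that by blast
qed

text \<open>Additivity of the power map reduces this to single terms. With
  \<open>N = l * m + 1\<close>, the power \<open>(x ^ i) ^ N\<close> is
  \<open>D ^ (m * i) * x ^ i\<close>, where \<open>D\<close> is 1 modulo \<open>g\<close>, and the
  coefficients are handled by the assumption \<open>c\<close>.\<close>

lemma power_card_cong:
  assumes c: "\<And>c. g dvd c ^ (card (UNIV :: 'a set) ^ e) - c" and gD: "g dvd D - 1" and y: "y \<in> OK K"
  shows "y ^ (card (UNIV :: 'a set) ^ e) - y \<in> gen_ideal g"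
proof -
  let ?N = "card (UNIV :: 'a set) ^ e"
  obtain m where m: "?N = l * m + 1" by (rule card_power_cong_1)
  obtain c where y: "y = (\<Sum>i<l. emb (c i) * x ^ i)" using y by (auto simp: OK_eq)
  have "(x ^ i) ^ ?N = emb (D ^ (m * i)) * x ^ i" for i
  proof -
    have "(x ^ i) ^ ?N = (x ^ l) ^ (m * i) * x ^ i"
      unfolding m by (simp add: algebra_simps flip: power_mult power_add)
    thus ?thesis by (simp add: x_root emb_hom.hom_power)
  qed
  hence "y ^ ?N = (\<Sum>i<l. emb (c i ^ ?N * D ^ (m * i)) * x ^ i)"
    unfolding y freshman_power_sum[OF fin comm_ring_hom_emb_const finite_lessThan]
    by (simp add: power_mult_distrib emb_mult emb_hom.hom_power mult_ac)
  hence "y ^ ?N - y = (\<Sum>i<l. emb (c i ^ ?N * D ^ (m * i) - c i) * x ^ i)"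
    unfolding y by (simp add: left_diff_distrib emb_hom.hom_minus flip: sum_subtractf)
  moreover have "g dvd c i ^ ?N * D ^ (m * i) - c i" for i
  proof -
    have "D - 1 dvd D ^ (m * i) - 1" using power_diff_1_eq[of D "m * i"] by simp
    hence "g dvd c i ^ ?N * (D ^ (m * i) - 1)" using gD dvd_trans dvd_mult by blast
    from dvd_add[OF this c[of "c i"]] show ?thesis by (simp add: algebra_simps)
  qed
  ultimately show ?thesis by (simp only: sum_in_gen_ideal_iff) simp
qed

text \<open>Modulo \<open>g\<close> the product \<open>(x - 1) * (1 + x + \<dots> + x ^ (l - 1)) = D - 1\<close> vanishes.\<close>

lemma quotient_not_field:
  assumes g: "degree g > 0" and gD: "g dvd D - 1"
  shows "\<not> field (OK_ring K Quot gen_ideal g)"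
proof
  assume "field (OK_ring K Quot gen_ideal g)"
  then interpret Q: domain "OK_ring K Quot gen_ideal g" by (rule field.axioms)
  interpret h: ring_hom_ring "OK_ring K" "OK_ring K Quot gen_ideal g" "residue_class g"
    by (rule residue_class_hom)
  have zero: "residue_class g a = \<zero>\<^bsub>OK_ring K Quot gen_ideal g\<^esub> \<longleftrightarrow> a \<in> gen_ideal g" if "a \<in> OK K" for a
    using h.hom_zero residue_class_eq_iff[OF that OK_0, of g] by (simp only: OK_ring_simps diff_zero)
  have ng: "\<not> g dvd 1" using g by (metis degree_1 dvd_imp_degree_le leD one_neq_zero)
  define s where "s = (\<Sum>i<l. x ^ i)"
  have sOK: "s \<in> OK K" unfolding s_def by (intro OK_sum OK_power OK_x)
  have xOK: "x - 1 \<in> OK K" by (intro OK_diff OK_x OK_1)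
  have "s \<notin> gen_ideal g"
    using sum_in_gen_ideal_iff[of "\<lambda>_. 1" g] ng l_gt_1 unfolding s_def by auto
  moreover have "x - 1 \<notin> gen_ideal g"
  proof -
    \<comment> \<open>The coordinates of \<open>x - 1\<close>; index 1 is available because
      \<open>l > 1\<close>, and the coordinate 1 there is not divisible by the non-constant
      \<open>g\<close>.\<close>
    let ?c = "\<lambda>i :: nat. if i = 0 then - 1 else if i = 1 then 1 else 0 :: 'a poly"
    have "(\<Sum>i<l. emb (?c i) * x ^ i) = (\<Sum>i\<in>{0, 1}. emb (?c i) * x ^ i)"
      using l_gt_1 by (intro sum.mono_neutral_right) auto
    also have "\<dots> = x - 1" by (simp add: emb_minus)
    finally show ?thesis using sum_in_gen_ideal_iff[of ?c g] ng l_gt_1 by auto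
  qed
  moreover have "(x - 1) * s \<in> gen_ideal g"
  proof -
    obtain k where k: "D - 1 = g * k" using gD by blast
    have "(x - 1) * s = emb (D - 1)"
      using power_diff_1_eq[of x l] by (simp add: s_def x_root emb_hom.hom_minus)
    also have "\<dots> = emb k * emb g" unfolding k by (simp add: emb_mult mult.commute)
    finally show ?thesis by (auto simp: gen_ideal_iff OK_emb)
  qed
  moreover have "residue_class g ((x - 1) * s) =
      residue_class g (x - 1) \<otimes>\<^bsub>OK_ring K Quot gen_ideal g\<^esub> residue_class g s"
    using h.hom_mult[of "x - 1" s] xOK sOK by simp
  ultimately show False
    using Q.integral[of "residue_class g (x - 1)" "residue_class g s"] zero xOK sOK OK_mult
    by (auto simp: carrier_quotient)
qed

lemma carmichael_in_K:
  assumes g: "squarefree g" "degree g > 0" and gD: "g dvd D - 1"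
    and deg: "\<And>P. irreducible P \<Longrightarrow> P dvd g \<Longrightarrow> degree P dvd degree g * l"
  shows "carmichael_in K g"
proof -
  have nz: "g \<noteq> 0" using g by auto
  interpret h: ring_hom_ring "OK_ring K" "OK_ring K Quot gen_ideal g" "residue_class g"
    by (rule residue_class_hom)
  let ?Q = "OK_ring K Quot gen_ideal g" and ?N = "card (UNIV :: 'a set) ^ (degree g * l)"
  have "A [^]\<^bsub>?Q\<^esub> ?N = A" if "A \<in> carrier ?Q" for A
  proof -
    obtain a where a: "a \<in> OK K" "A = residue_class g a" using \<open>A \<in> carrier ?Q\<close> by (auto simp: carrier_quotient)
    have "A [^]\<^bsub>?Q\<^esub> ?N = residue_class g (a ^ ?N)"
      using h.hom_nat_pow[of a ?N] a by (simp add: OK_ring_pow)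
    also have "\<dots> = A"
      unfolding a(2) residue_class_eq_iff[OF OK_power[OF a(1)] a(1)]
      by (rule power_card_cong[OF fermat_poly_squarefree[OF fin g(1) nz deg] gD a(1)])
    finally show ?thesis .
  qed
  thus ?thesis
    unfolding carmichael_in_def carmichael_ideal_def carmichael_ring_def gen_ideal_def[symmetric]
    using ideal_gen_ideal card_quotient[OF nz] quotient_not_field[OF g(2) gD]
      ideal.quotient_is_ring[OF ideal_gen_ideal] by simp
qed

end

section \<open>Infinitely many extensions\<close>

text \<open>A generator of the Galois group multiplies any \<open>l\<close>-th root in \<open>K\<close> of a polynomial by some
  \<open>zeta ^ k\<close>, so that root is a multiple of \<open>x ^ k\<close>.\<close>

lemma (in kummer) degree_eq_if_root_in_K:
  assumes y: "y \<in> K" "y ^ l = emb E" and E: "squarefree E" "degree E > 0"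
  shows "degree E = degree D"
proof -
  \<comment> \<open>Viewing \<open>y\<close> as a Kummer generator for \<open>E\<close> provides its
    list of conjugates and its integrality.\<close>
  interpret E: kummer l z E y
    using fin prime_l l_dvd z_root z_ne E y(2) by unfold_locales
  have Ezeta: "E.zeta = zeta" by (simp add: zeta_def E.zeta_def)
  have "sigma 1 y ^ l = emb E" by (metis y sigma_power sigma_base_field emb_in_base_field)
  then obtain k where k: "k < l" "sigma 1 y = zeta ^ k * y"
    using E.root_is_conjugate Ezeta by metis
  have "y \<in> OK K" using y(1) E.integral_x by (simp add: OK_iff)
  then obtain c where c: "y = (\<Sum>i<l. emb (c i) * x ^ i)" by (auto simp: OK_eq)
  \<comment> \<open>Both sides are \<open>sigma 1 y\<close>, computed by coordinates and as a
    scaling of \<open>y\<close>; coordinates at which the two eigenvalues differ must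
    vanish.\<close>
  have "(\<Sum>i<l. emb (c i) * zeta ^ i * x ^ i) = (\<Sum>i<l. zeta ^ k * emb (c i) * x ^ i)"
    using k(2) sigma_coords[of "\<lambda>i. emb (c i)" 1] unfolding c
    by (simp add: sum_distrib_left mult.assoc)
  hence eq: "emb (c i) * zeta ^ i = zeta ^ k * emb (c i)" if "i < l" for i
    using powers_coeff_unique[of "\<lambda>i. emb (c i) * zeta ^ i" "\<lambda>i. zeta ^ k * emb (c i)" i] that
    by (simp add: base_field_mult)
  have zero: "emb (c i) = 0" if "i < l" "i \<noteq> k" for i
  proof -
    have "zeta ^ i \<noteq> zeta ^ k" using zeta_power_inj that k(1) by (auto dest: inj_onD)
    moreover have "(zeta ^ i - zeta ^ k) * emb (c i) = 0" using eq[OF that(1)] by (simp add: algebra_simps)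
    ultimately show ?thesis by simp
  qed
  have "(\<Sum>i<l. emb (c i) * x ^ i) = (\<Sum>i\<in>{k}. emb (c i) * x ^ i)"
    by (rule sum.mono_neutral_right) (use k(1) zero in auto)
  hence "y = emb (c k) * x ^ k" unfolding c by simp
  hence "y ^ l = emb (c k) ^ l * (x ^ l) ^ k"
    by (simp add: power_mult_distrib mult.commute flip: power_mult)
  hence "emb E = emb (c k ^ l * D ^ k)" using y(2) by (simp add: x_root emb_mult emb_hom.hom_power)
  hence EE: "E = c k ^ l * D ^ k" by simp
  have nz: "c k \<noteq> 0" using E(2) l_gt_1 unfolding EE by (auto simp: power_0_left)
  \<comment> \<open>Squarefreeness of \<open>E = c k ^ l * D ^ k\<close> leaves only a constant
    \<open>c k\<close> and \<open>k\<close> at most 1; \<open>k = 0\<close> is impossible because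
    \<open>E\<close> is not constant.\<close>
  have "c k ^ 2 dvd c k ^ l" using l_gt_1 by (intro le_imp_power_dvd) simp
  hence "c k ^ 2 dvd E" unfolding EE by simp
  hence "is_unit (c k)" using E(1) unfolding squarefree_def by blast
  hence 0: "degree (c k ^ l) = 0" using nz by (simp add: is_unit_iff_degree Polynomial.degree_power_eq)
  have "k < 2"
  proof (rule ccontr)
    assume "\<not> k < 2"
    hence "D ^ 2 dvd D ^ k" by (intro le_imp_power_dvd) simp
    hence "D ^ 2 dvd E" unfolding EE by simp
    hence "is_unit D" using E(1) unfolding squarefree_def by blast
    thus False using deg_D D_nz by (simp add: is_unit_iff_degree)
  qed
  moreover have deg: "degree E = k * degree D"
    unfolding EE using nz D_nz 0 by (simp add: degree_mult_eq Polynomial.degree_power_eq)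
  ultimately show ?thesis using E(2) by (cases k) auto
qed

text \<open>The derivative of \<open>1 + t * g ^ m\<close> is \<open>g ^ m\<close>.\<close>

lemma squarefree_one_plus_power:
  fixes g :: "'a::field poly"
  assumes "of_nat m = (0 :: 'a)"
  shows "squarefree (1 + [:0, 1:] * g ^ m)"
  unfolding squarefree_def
proof (intro allI impI)
  fix a assume "a ^ 2 dvd 1 + [:0, 1:] * g ^ m"
  then obtain b where b: "1 + [:0, 1:] * g ^ m = a * (a * b)" unfolding power2_eq_square dvd_def mult.assoc by blast
  have "pderiv (g ^ m) = 0" using assms by (simp add: pderiv_power)
  hence "g ^ m = pderiv (1 + [:0, 1:] * g ^ m)"
    by (simp add: pderiv_add pderiv_mult pderiv_pCons)
  also have "\<dots> = a * (pderiv (a * b) + b * pderiv a)"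
    unfolding b by (simp add: pderiv_mult algebra_simps)
  finally have "a dvd g ^ m" by simp
  hence "a dvd [:0, 1:] * g ^ m" by (rule dvd_mult)
  moreover have "a dvd 1 + [:0, 1:] * g ^ m" unfolding b by simp
  ultimately show "a dvd 1" using dvd_add_left_iff by blast
qed

theorem theorem5p5:
  fixes g :: "'a::field poly" and l :: nat
  assumes fin: "finite (UNIV :: 'a set)"
    and q3: "card (UNIV :: 'a set) \<ge> 3"
    and nonconst: "degree g > 0"
    and sqf: "squarefree g"
    and lprime: "prime l" and ldvd: "l dvd card (UNIV :: 'a set) - 1"
    and degs: "\<And>P. lead_coeff P = 1 \<Longrightarrow> irreducible P \<Longrightarrow> P dvd g \<Longrightarrow>
                 \<not> (degree P dvd degree g) \<Longrightarrow> degree P = l"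
  shows "infinite {K :: 'a omega set. cyclic_ext K l \<and> disc_coprime K g \<and> carmichael_in K g}"
proof -
  let ?q = "card (UNIV :: 'a set)"
  obtain z :: 'a where z: "z ^ l = 1" "z \<noteq> 1" using primitive_root_exists[OF fin lprime ldvd] .
  have l0: "l > 0" using lprime by (rule prime_gt_0_nat)
  have q0: "?q > 0" using q3 by simp
  have gnz: "g \<noteq> 0" using nonconst by auto
  \<comment> \<open>A multiple of \<open>q\<close> as exponent makes the derivative of the power
    vanish, as \<open>squarefree_one_plus_power\<close> needs. \<open>Suc n\<close> keeps the
    exponent positive, so that \<open>g\<close> divides \<open>D n - 1\<close>.\<close>
  define D where "D n = 1 + [:0, 1:] * g ^ (?q * Suc n)" for n
  have "\<forall>n. \<exists>y. y ^ l = emb (D n)" using nth_root_exists[OF l0] by blast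
  then obtain x where x: "\<And>n. x n ^ l = emb (D n)" by metis
  have degD: "degree (D n) = 1 + ?q * Suc n * degree g" for n
  proof -
    have "degree ([:0, 1:] * g ^ (?q * Suc n)) = 1 + ?q * Suc n * degree g"
      using gnz by (subst degree_mult_eq) (auto simp: Polynomial.degree_power_eq)
    thus ?thesis unfolding D_def by (subst degree_add_eq_right) auto
  qed
  have "of_nat (?q * Suc n) = (0 :: 'a)" for n using of_nat_card_UNIV[OF fin] by simp
  hence sqfD: "squarefree (D n)" for n unfolding D_def by (rule squarefree_one_plus_power)
  have gD: "g dvd D n - 1" for n
  proof -
    have "g dvd g ^ (?q * Suc n)" using q0 by (intro dvd_power) auto
    hence "g dvd [:0, 1:] * g ^ (?q * Suc n)" by (rule dvd_mult)
    thus ?thesis by (simp only: D_def add_diff_cancel_left')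
  qed
  have kummer: "kummer l z (D n) (x n)" for n
    using fin lprime ldvd z sqfD x by unfold_locales (simp_all add: degD)
  have deg: "degree P dvd degree g * l" if P: "irreducible P" "P dvd g" for P
  proof -
    \<comment> \<open>The degree hypothesis speaks of monic factors, hence the normalisation. The
      degree of \<open>P\<close> divides \<open>degree g\<close> or equals \<open>l\<close>, and
      either way divides their product.\<close>
    define P' where "P' = smult (inverse (lead_coeff P)) P"
    have nz: "P \<noteq> 0" using P(1) by auto
    have "lead_coeff P' = 1" "irreducible P'" "P' dvd g" "degree P' = degree P"
      using nz P irreducible_mult_unit_left[of "[:inverse (lead_coeff P):]" P]
      by (simp_all add: P'_def smult_dvd_iff is_unit_const_poly_iff dvd_field_iff)
    thus ?thesis using degs[of P'] by (cases "degree P dvd degree g") auto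
  qed
  have cop: "\<not> P dvd D n" if P: "irreducible P" "P dvd g" for P n
  proof
    assume "P dvd D n"
    moreover have "P dvd D n - 1" using P(2) gD by (rule dvd_trans)
    ultimately have "P dvd D n - (D n - 1)" by (rule dvd_diff)
    thus False using P(1) by (simp add: irreducible_def)
  qed
  define F where "F n = kummer.K (x n)" for n
  have "inj F"
  proof (rule injI)
    fix n m assume eq: "F n = F m"
    interpret n: kummer l z "D n" "x n" by (rule kummer)
    interpret m: kummer l z "D m" "x m" by (rule kummer)
    \<comment> \<open>Equal fields contain each other's roots, so \<open>D m\<close> and
      \<open>D n\<close> have the same degree; by \<open>degD\<close> the degree determines the
      index.\<close>
    have "x m \<in> n.K" using m.x_in_K eq by (simp add: F_def)
    hence "degree (D m) = degree (D n)"
      using n.degree_eq_if_root_in_K x sqfD m.deg_D by blast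
    thus "n = m" using q0 nonconst by (simp add: degD)
  qed
  hence "infinite (range F)" by (rule range_inj_infinite)
  moreover have "range F \<subseteq> {K. cyclic_ext K l \<and> disc_coprime K g \<and> carmichael_in K g}"
  proof (rule image_subsetI)
    fix n
    interpret n: kummer l z "D n" "x n" by (rule kummer)
    show "F n \<in> {K. cyclic_ext K l \<and> disc_coprime K g \<and> carmichael_in K g}"
      using n.cyclic_ext_K n.disc_coprime_K[OF cop] n.carmichael_in_K[OF sqf nonconst gD deg]
      by (simp add: F_def)
  qed
  ultimately show ?thesis using finite_subset by blast
qed

end
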